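(* Let $(X_t)_{t\ge 0}$ be a symmetric $\mathbb R^d$-valued Lévy process as in the context, let $V$ be an $X$-Kato class potential such that $\lambda_0=\inf\operatorname{Spec}H$ is an isolated eigenvalue of $H=-L+V$, let $\varphi_0$ be the corresponding ground state, and let $\widetilde X$ be the corresponding ground state-transformed process with path measure $\widetilde{\mathbb P}$. Then for every non-decreasing function $\tau:[0,\infty)\to(0,\infty)$, $$\limsup_{n\to\infty}\frac{|\widetilde X_n|}{\tau(n)}=c_{\varphi_0}(\tau),\qquad \widetilde{\mathbb P}\text{-a.s.},$$ where $$c_{\varphi_0}(\tau)=\inf\{c>0: I_{\varphi_0}(c,\tau)<\infty\}\in[0,\infty],\qquad I_{\varphi_0}(c,\tau)=\int_1^\infty dr\int_{|x|\ge\tau(r)}\varphi_0^2(cx)\,dx,$$ with $\inf\emptyset=\infty$.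
   Context: Lévy process: $d\ge1$; $(X_t)_{t\ge0}$ is an $\mathbb R^d$-valued Lévy process ($\mathbb P^x,\mathbb E^x$: law and expectation when started at $x$) with $\mathbb E^0[e^{i\xi\cdot X_t}]=e^{-t\psi(\xi)}$, $\psi(\xi)=A\xi\cdot\xi+\int_{\mathbb R^d}(1-\cos(\xi\cdot z))\,\nu(dz)$, where $A$ is a symmetric non-negative definite $d\times d$ matrix and $\nu$ is a symmetric Lévy measure with $\nu(\mathbb R^d\setminus\{0\})=\infty$ and $\nu(dx)=\nu(x)dx$ with density $\nu(x)>0$. Its $L^2(\mathbb R^d)$-generator $L$ is given by $\widehat{Lf}=-\psi\widehat f$. Potential: a Borel function $V:\mathbb R^d\to\mathbb R$ is of $X$-Kato class if $V_-\in\mathcal K^X$ and $V_+1_C\in\mathcal K^X$ for every compact $C\subset\mathbb R^d$, where $h\in\mathcal K^X$ means $\lim_{t\downarrow0}\sup_{x\in\mathbb R^d}\mathbb E^x\big[\int_0^t|h(X_s)|ds\big]=0$. The operators $T_tf(x)=\mathbb E^x[e^{-\int_0^tV(X_s)ds}f(X_t)]$ form a strongly continuous symmetric semigroup on $L^2(\mathbb R^d)$, and $H=-L+V$ (form sum) is the self-adjoint operator, bounded from below, with $T_t=e^{-tH}$. Ground state: when $\lambda_0=\inf\operatorname{Spec}H\in\mathbb R$ is an isolated eigenvalue of $H$, $\varphi_0$ denotes its unique strictly positive eigenfunction with $\|\varphi_0\|_{L^2}=1$. Ground state-transformed (GST) process: $\widetilde T_tf=\frac{e^{\lambda_0t}}{\varphi_0}T_t(\varphi_0f)$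 is a Markov semigroup on $L^2(\mathbb R^d,\varphi_0^2dx)$. The GST process $(\widetilde X_t)_{t\in\mathbb R}$ is the associated stationary càdlàg Markov process on two-sided càdlàg path space; $\widetilde{\mathbb P}^x$ is its law with $\widetilde X_0=x$, and its path measure is $\widetilde{\mathbb P}(\cdot)=\int_{\mathbb R^d}\widetilde{\mathbb P}^x(\cdot)\varphi_0^2(x)dx$. Thus for $t_0\le\dots\le t_n$, $\mathbb E_{\widetilde{\mathbb P}}[\prod_{j=0}^nf_j(\widetilde X_{t_j})]=(f_0,\widetilde T_{t_1-t_0}f_1\cdots\widetilde T_{t_n-t_{n-1}}f_n)_{L^2(\mathbb R^d,\varphi_0^2dx)}$ for $f_0,f_n\in L^2(\mathbb R^d,\varphi_0^2dx)$ and bounded $f_1,\dots,f_{n-1}$. *)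

theory Defs
  imports "HOL-Probability.Probability"
begin

section \<open>Levy processes\<close>

text \<open>On \<open>S = {0..}\<close> the left limit at \<open>0\<close> is a limit along the trivial filter,
  hence no condition.\<close>

definition cadlag_on :: "real set \<Rightarrow> (real \<Rightarrow> 'a::topological_space) \<Rightarrow> bool" where
  "cadlag_on S f \<longleftrightarrow> (\<forall>t\<in>S. (f \<longlongrightarrow> f t) (at t within S \<inter> {t<..}) \<and>
                          (\<exists>l. (f \<longlongrightarrow> l) (at t within S \<inter> {..<t})))"

definition levy_process :: "'w measure \<Rightarrow> (real \<Rightarrow> 'w \<Rightarrow> 'a::euclidean_space) \<Rightarrow> bool" where
  "levy_process M X \<longleftrightarrow>
     prob_space M \<and>
     (\<forall>t\<ge>0. X t \<in> borel_measurable M) \<and>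
     (AE w in M. X 0 w = 0) \<and>
     (\<forall>n (t :: nat \<Rightarrow> real). 0 \<le> t 0 \<and> (\<forall>i<n. t i \<le> t (Suc i)) \<longrightarrow>
        prob_space.indep_vars M (\<lambda>_. borel) (\<lambda>i w. X (t (Suc i)) w - X (t i) w) {..<n}) \<and>
     (\<forall>s\<ge>0. \<forall>t\<ge>0. distr M borel (\<lambda>w. X (s + t) w - X s w) = distr M borel (X t)) \<and>
     (\<forall>w\<in>space M. cadlag_on {0..} (\<lambda>t. X t w))"

definition levy_measure :: "'a::euclidean_space measure \<Rightarrow> bool" where
  "levy_measure N \<longleftrightarrow> sets N = sets borel \<and> emeasure N {0} = 0 \<and>
     (\<integral>\<^sup>+ z. ennreal (min 1 ((norm z)\<^sup>2)) \<partial>N) < \<infinity>"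

definition symmetric_measure :: "'a::euclidean_space measure \<Rightarrow> bool" where
  "symmetric_measure N \<longleftrightarrow> distr N borel uminus = N"

definition levy_symbol :: "real^'n^'n \<Rightarrow> (real^'n) measure \<Rightarrow> real^'n \<Rightarrow> real" where
  "levy_symbol A N \<xi> = (A *v \<xi>) \<bullet> \<xi> + (\<integral>z. 1 - cos (\<xi> \<bullet> z) \<partial>N)"

section \<open>Kato class and Feynman--Kac semigroup\<close>

text \<open>By translation invariance, the process started at \<open>x\<close> is \<open>x + X\<close> under the law \<open>M\<close>
  of the process started at \<open>0\<close>.\<close>

definition kato_class :: "'w measure \<Rightarrow> (real \<Rightarrow> 'w \<Rightarrow> 'a::euclidean_space) \<Rightarrow> ('a \<Rightarrow> real) set" where
  "kato_class M X = {h. h \<in> borel_measurable borel \<and>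
     ((\<lambda>t. SUP x. \<integral>\<^sup>+ w. (\<integral>\<^sup>+ s\<in>{0..t}. ennreal \<bar>h (x + X s w)\<bar> \<partial>lborel) \<partial>M) \<longlongrightarrow> 0)
       (at_right 0)}"

definition kato_potential :: "'w measure \<Rightarrow> (real \<Rightarrow> 'w \<Rightarrow> 'a::euclidean_space) \<Rightarrow> ('a \<Rightarrow> real) \<Rightarrow> bool" where
  "kato_potential M X V \<longleftrightarrow>
     V \<in> borel_measurable borel \<and>
     (\<lambda>x. max 0 (- V x)) \<in> kato_class M X \<and>
     (\<forall>C. compact C \<longrightarrow> (\<lambda>x. max 0 (V x) * indicator C x) \<in> kato_class M X)"

definition feynman_kac ::
  "'w measure \<Rightarrow> (real \<Rightarrow> 'w \<Rightarrow> 'a::euclidean_space) \<Rightarrow> ('a \<Rightarrow> real) \<Rightarrow> real \<Rightarrow> ('a \<Rightarrow> real) \<Rightarrow> 'a \<Rightarrow> real" where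
  "feynman_kac M X V t f x =
     (\<integral>w. exp (- (LINT s:{0..t}|lborel. V (x + X s w))) * f (x + X t w) \<partial>M)"

section \<open>Operators on real \<open>L\<^sup>2\<close>\<close>

text \<open>Elements of \<open>L\<^sup>2\<close> are represented by measurable functions, with equality understood almost
  everywhere. An unbounded operator is represented by its graph, a set of pairs \<open>(f, h)\<close>
  meaning that \<open>f\<close> is in the domain and is mapped to \<open>h\<close>.\<close>

definition L2 :: "'a measure \<Rightarrow> ('a \<Rightarrow> real) set" where
  "L2 M = {f. f \<in> borel_measurable M \<and> integrable M (\<lambda>x. (f x)\<^sup>2)}"

definition L2_inner :: "'a measure \<Rightarrow> ('a \<Rightarrow> real) \<Rightarrow> ('a \<Rightarrow> real) \<Rightarrow> real" where
  "L2_inner M f g = (\<integral>x. f x * g x \<partial>M)"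

definition L2_norm :: "'a measure \<Rightarrow> ('a \<Rightarrow> real) \<Rightarrow> real" where
  "L2_norm M f = sqrt (L2_inner M f f)"

type_synonym 'a operator = "(('a \<Rightarrow> real) \<times> ('a \<Rightarrow> real)) set"

definition self_adjoint :: "'a::euclidean_space operator \<Rightarrow> bool" where
  "self_adjoint H \<longleftrightarrow>
     (\<forall>f\<in>L2 lborel. \<forall>\<epsilon>>0. \<exists>g k. (g, k) \<in> H \<and> L2_norm lborel (\<lambda>x. g x - f x) < \<epsilon>) \<and>
     H = {(f, h). f \<in> L2 lborel \<and> h \<in> L2 lborel \<and>
            (\<forall>(g, k)\<in>H. L2_inner lborel f k = L2_inner lborel h g)}"

definition bounded_from_below :: "'a::euclidean_space operator \<Rightarrow> bool" where
  "bounded_from_below H \<longleftrightarrow>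
     (\<exists>c. \<forall>(f, h)\<in>H. c * L2_inner lborel f f \<le> L2_inner lborel h f)"

text \<open>The spectrum of a self-adjoint operator is real, and for real spectral parameters invertibility
  of \<open>H - \<mu>\<close> on real \<open>L\<^sup>2\<close> and on its complexification are the same.\<close>

definition resolvent_set :: "'a::euclidean_space operator \<Rightarrow> real set" where
  "resolvent_set H = {\<mu>.
     (\<forall>g\<in>L2 lborel. \<exists>f h. (f, h) \<in> H \<and> (AE x in lborel. h x - \<mu> * f x = g x)) \<and>
     (\<exists>C. \<forall>(f, h)\<in>H. L2_norm lborel f \<le> C * L2_norm lborel (\<lambda>x. h x - \<mu> * f x))}"

definition Spec :: "'a::euclidean_space operator \<Rightarrow> real set" where
  "Spec H = - resolvent_set H"

definition eigenfunction :: "'a::euclidean_space operator \<Rightarrow> real \<Rightarrow> ('a \<Rightarrow> real) \<Rightarrow> bool" where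
  "eigenfunction H \<mu> f \<longleftrightarrow> (f, \<lambda>x. \<mu> * f x) \<in> H \<and> \<not> (AE x in lborel. f x = 0)"

definition isolated_eigenvalue :: "'a::euclidean_space operator \<Rightarrow> real \<Rightarrow> bool" where
  "isolated_eigenvalue H \<mu> \<longleftrightarrow> (\<exists>f. eigenfunction H \<mu> f) \<and> \<mu> isolated_in Spec H"

definition strongly_continuous_semigroup ::
  "(real \<Rightarrow> ('a::euclidean_space \<Rightarrow> real) \<Rightarrow> 'a \<Rightarrow> real) \<Rightarrow> bool" where
  "strongly_continuous_semigroup T \<longleftrightarrow>
     (\<forall>t\<ge>0. \<forall>f\<in>L2 lborel. T t f \<in> L2 lborel) \<and>
     (\<forall>t\<ge>0. \<forall>f\<in>L2 lborel. \<forall>g\<in>L2 lborel. \<forall>a b.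
        AE x in lborel. T t (\<lambda>y. a * f y + b * g y) x = a * T t f x + b * T t g x) \<and>
     (\<forall>t\<ge>0. \<exists>C. \<forall>f\<in>L2 lborel. L2_norm lborel (T t f) \<le> C * L2_norm lborel f) \<and>
     (\<forall>f\<in>L2 lborel. AE x in lborel. T 0 f x = f x) \<and>
     (\<forall>s\<ge>0. \<forall>t\<ge>0. \<forall>f\<in>L2 lborel. AE x in lborel. T (s + t) f x = T s (T t f) x) \<and>
     (\<forall>f\<in>L2 lborel. ((\<lambda>t. L2_norm lborel (\<lambda>x. T t f x - f x)) \<longlongrightarrow> 0) (at_right 0))"

text \<open>\<open>T\<^sub>t = e\<^sup>-\<^sup>t\<^sup>H\<close> for all \<open>t \<ge> 0\<close>: the operator \<open>-H\<close> is the infinitesimal generator of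
  the strongly continuous semigroup \<open>T\<close>.\<close>

definition is_exp_semigroup ::
  "(real \<Rightarrow> ('a::euclidean_space \<Rightarrow> real) \<Rightarrow> 'a \<Rightarrow> real) \<Rightarrow> 'a operator \<Rightarrow> bool" where
  "is_exp_semigroup T H \<longleftrightarrow> strongly_continuous_semigroup T \<and>
     H = {(f, h). f \<in> L2 lborel \<and> h \<in> L2 lborel \<and>
            ((\<lambda>t. L2_norm lborel (\<lambda>x. (f x - T t f x) / t - h x)) \<longlongrightarrow> 0) (at_right 0)}"

section \<open>The generator \<open>L\<close> and the form sum \<open>-L + V\<close>\<close>

definition fourier :: "('a::euclidean_space \<Rightarrow> real) \<Rightarrow> 'a \<Rightarrow> complex" where
  "fourier f \<xi> = (\<integral>x. cis (- (\<xi> \<bullet> x)) * of_real (f x) \<partial>lborel)"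

text \<open>\<open>F\<close> is a version of the Fourier--Plancherel transform of \<open>f\<close>, the
  \<open>L\<^sup>2\<close>-continuous extension of \<^const>\<open>fourier\<close> from \<open>L\<^sup>1 \<inter> L\<^sup>2\<close>.\<close>

definition is_fourier_L2 :: "('a::euclidean_space \<Rightarrow> real) \<Rightarrow> ('a \<Rightarrow> complex) \<Rightarrow> bool" where
  "is_fourier_L2 f F \<longleftrightarrow> f \<in> L2 lborel \<and> F \<in> borel_measurable lborel \<and>
     (\<exists>g. (\<forall>n. g n \<in> L2 lborel \<and> integrable lborel (g n)) \<and>
        (\<lambda>n. L2_norm lborel (\<lambda>x. g n x - f x)) \<longlonglongrightarrow> 0 \<and>
        (\<lambda>n. \<integral>\<^sup>+ \<xi>. ennreal ((cmod (fourier (g n) \<xi> - F \<xi>))\<^sup>2) \<partial>lborel) \<longlonglongrightarrow> 0)"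

definition levy_generator :: "('a::euclidean_space \<Rightarrow> real) \<Rightarrow> 'a operator" where
  "levy_generator \<psi> = {(f, h). \<exists>F. is_fourier_L2 f F \<and>
                               is_fourier_L2 h (\<lambda>\<xi>. - of_real (\<psi> \<xi>) * F \<xi>)}"

definition neg_operator :: "'a operator \<Rightarrow> 'a operator" where
  "neg_operator B = {(f, h). (f, \<lambda>x. - h x) \<in> B}"

text \<open>For a non-negative self-adjoint \<open>B\<close>, the associated closed form is the closure of
  \<open>(f, g) \<mapsto> (B f, g)\<close>. A function \<open>f\<close> is in its domain if there are \<open>u n\<close> in the domain of \<open>B\<close>,
  with \<open>B (u n) = b n\<close>, which converge to \<open>f\<close> in \<open>L\<^sup>2\<close> and are Cauchy for the form.\<close>

definition form_converges ::
  "'a::euclidean_space operator \<Rightarrow> (nat \<Rightarrow> 'a \<Rightarrow> real) \<Rightarrow> (nat \<Rightarrow> 'a \<Rightarrow> real) \<Rightarrow> ('a \<Rightarrow> real) \<Rightarrow> bool" where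
  "form_converges B u b f \<longleftrightarrow>
     (\<forall>n. (u n, b n) \<in> B) \<and>
     (\<lambda>n. L2_norm lborel (\<lambda>x. u n x - f x)) \<longlonglongrightarrow> 0 \<and>
     (\<forall>\<epsilon>>0. \<exists>N. \<forall>m\<ge>N. \<forall>n\<ge>N.
        L2_inner lborel (\<lambda>x. b m x - b n x) (\<lambda>x. u m x - u n x) < \<epsilon>)"

definition form_domain :: "'a::euclidean_space operator \<Rightarrow> ('a \<Rightarrow> real) set" where
  "form_domain B = {f \<in> L2 lborel. \<exists>u b. form_converges B u b f}"

definition form_value ::
  "'a::euclidean_space operator \<Rightarrow> ('a \<Rightarrow> real) \<Rightarrow> ('a \<Rightarrow> real) \<Rightarrow> real \<Rightarrow> bool" where
  "form_value B f g e \<longleftrightarrow> (\<exists>u b v c. form_converges B u b f \<and> form_converges B v c g \<and>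
     (\<lambda>n. L2_inner lborel (b n) (v n)) \<longlonglongrightarrow> e)"

text \<open>The operator associated with the sum of the form of \<open>B\<close> and the form of multiplication
  by \<open>V\<close>, on the intersection of the two form domains.\<close>

definition form_sum :: "'a::euclidean_space operator \<Rightarrow> ('a \<Rightarrow> real) \<Rightarrow> 'a operator" where
  "form_sum B V =
     (let Q = {f \<in> form_domain B. integrable lborel (\<lambda>x. \<bar>V x\<bar> * (f x)\<^sup>2)}
      in {(f, h). f \<in> Q \<and> h \<in> L2 lborel \<and>
            (\<forall>g\<in>Q. \<exists>e. form_value B f g e \<and>
               e + (\<integral>x. V x * f x * g x \<partial>lborel) = L2_inner lborel h g)})"

section \<open>Ground state and ground state-transformed process\<close>

definition ground_state :: "'a::euclidean_space operator \<Rightarrow> ('a \<Rightarrow> real) \<Rightarrow> bool" where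
  "ground_state H \<phi> \<longleftrightarrow>
     (let P = (\<lambda>f. eigenfunction H (Inf (Spec H)) f \<and> (AE x in lborel. 0 < f x) \<and>
                   L2_norm lborel f = 1)
      in P \<phi> \<and> (\<forall>f. P f \<longrightarrow> (AE x in lborel. f x = \<phi> x)))"

definition weighted :: "('a::euclidean_space \<Rightarrow> real) \<Rightarrow> 'a measure" where
  "weighted \<phi> = density lborel (\<lambda>x. ennreal ((\<phi> x)\<^sup>2))"

definition gst_semigroup ::
  "(real \<Rightarrow> ('a \<Rightarrow> real) \<Rightarrow> 'a \<Rightarrow> real) \<Rightarrow> real \<Rightarrow> ('a \<Rightarrow> real) \<Rightarrow> real \<Rightarrow> ('a \<Rightarrow> real) \<Rightarrow> 'a \<Rightarrow> real" where
  "gst_semigroup T \<mu>\<^sub>0 \<phi> t f x = exp (\<mu>\<^sub>0 * t) / \<phi> x * T t (\<lambda>y. \<phi> y * f y) x"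

text \<open>\<open>semigroup_chain n S t f\<close> is
  \<open>S\<^bsub>t 1 - t 0\<^esub> (f 1 \<cdot> S\<^bsub>t 2 - t 1\<^esub> (f 2 \<cdot> \<dots> S\<^bsub>t n - t (n-1)\<^esub> (f n) \<dots>))\<close>.\<close>

primrec semigroup_chain ::
  "nat \<Rightarrow> (real \<Rightarrow> ('a \<Rightarrow> real) \<Rightarrow> 'a \<Rightarrow> real) \<Rightarrow> (nat \<Rightarrow> real) \<Rightarrow> (nat \<Rightarrow> 'a \<Rightarrow> real) \<Rightarrow> 'a \<Rightarrow> real" where
  "semigroup_chain 0 S t f = (\<lambda>x. 1)"
| "semigroup_chain (Suc n) S t f =
     S (t 1 - t 0) (\<lambda>x. f 1 x * semigroup_chain n S (\<lambda>i. t (Suc i)) (\<lambda>i. f (Suc i)) x)"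

text \<open>Two-sided cadlag path space with the \<open>\<sigma>\<close>-algebra generated by the coordinates;
  the process \<open>\<omega> \<mapsto> \<omega> t\<close> is the coordinate process.\<close>

definition path_space :: "(real \<Rightarrow> 'a::euclidean_space) measure" where
  "path_space = restrict_space (Pi\<^sub>M UNIV (\<lambda>_. borel)) {\<omega>. cadlag_on UNIV \<omega>}"

definition path_measure ::
  "('a::euclidean_space \<Rightarrow> real) \<Rightarrow> ('a \<Rightarrow> (real \<Rightarrow> 'a) measure) \<Rightarrow> (real \<Rightarrow> 'a) measure" where
  "path_measure \<phi> Px = weighted \<phi> \<bind> Px"

text \<open>\<open>Px x\<close> is the law of the process started at \<open>x\<close> at time \<open>0\<close>; \<open>S\<close> is the ground
  state-transformed semigroup. The Markov property and stationarity are contained in the formula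
  for the finite-dimensional distributions.\<close>

definition gst_process ::
  "(real \<Rightarrow> ('a \<Rightarrow> real) \<Rightarrow> 'a \<Rightarrow> real) \<Rightarrow> ('a::euclidean_space \<Rightarrow> real) \<Rightarrow>
   ('a \<Rightarrow> (real \<Rightarrow> 'a) measure) \<Rightarrow> bool" where
  "gst_process S \<phi> Px \<longleftrightarrow>
     Px \<in> borel \<rightarrow>\<^sub>M prob_algebra path_space \<and>
     (\<forall>x. AE \<omega> in Px x. \<omega> 0 = x) \<and>
     (\<forall>n\<ge>1. \<forall>(t :: nat \<Rightarrow> real) f.
        (\<forall>i<n. t i \<le> t (Suc i)) \<and>
        f 0 \<in> L2 (weighted \<phi>) \<and> f n \<in> L2 (weighted \<phi>) \<and>
        (\<forall>j. 0 < j \<and> j < n \<longrightarrow> f j \<in> borel_measurable borel \<and> bounded (range (f j))) \<longrightarrow>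
        (\<integral>\<omega>. (\<Prod>j\<le>n. f j (\<omega> (t j))) \<partial>path_measure \<phi> Px) =
          L2_inner (weighted \<phi>) (f 0) (semigroup_chain n S t f))"

section \<open>The integral test\<close>

definition I_fun :: "('a::euclidean_space \<Rightarrow> real) \<Rightarrow> real \<Rightarrow> (real \<Rightarrow> real) \<Rightarrow> ennreal" where
  "I_fun \<phi> c \<tau> =
     (\<integral>\<^sup>+ r\<in>{1..}. (\<integral>\<^sup>+ x\<in>{x. \<tau> r \<le> norm x}. ennreal ((\<phi> (c *\<^sub>R x))\<^sup>2) \<partial>lborel) \<partial>lborel)"

definition c_fun :: "('a::euclidean_space \<Rightarrow> real) \<Rightarrow> (real \<Rightarrow> real) \<Rightarrow> ennreal" where
  "c_fun \<phi> \<tau> = Inf {ennreal c |c. 0 < c \<and> I_fun \<phi> c \<tau> < \<infinity>}"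

end

theory Submission
  imports Defs
begin

text \<open>
  The transformed process is stationary with one-dimensional marginal \<open>\<phi>\<^sub>0\<^sup>2 dx\<close>, so the integral
  \<open>I(c, \<tau>)\<close> is finite if and only if the probabilities of the events \<open>A\<^sub>n = {\<bar>X\<^sub>n\<bar> \<ge> c \<tau>(n)}\<close> are
  summable (\<open>I_fun_finite_iff\<close>). If it is finite, the first Borel--Cantelli lemma shows that only
  finitely many \<open>A\<^sub>n\<close> occur. If it is infinite, almost surely infinitely many \<open>A\<^sub>n\<close> occur, by a second
  Borel--Cantelli lemma (\<open>borel_cantelli_decaying_correlations\<close>) in which independence is replaced by
  exponentially decaying correlations. This dichotomy, for all rational \<open>c\<close> at once, determines the
  upper limit (\<open>AE_limsup_eq_threshold\<close>).

  The decay of correlations (\<open>correlation_decay\<close>) comes from the spectral gap above the ground state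
  energy \<open>E\<^sub>0\<close>. By stationarity, \<open>Q\<^sub>t = e\<^bsup>E\<^sub>0 t\<^esup> T\<^sub>t\<close> is a contraction semigroup on \<open>L\<^sup>2\<close>, and minus
  its generator is \<open>A = H - E\<^sub>0\<close>. The fixed vectors of \<open>Q\<close> are the multiples of \<open>\<phi>\<^sub>0\<close>: with \<open>f\<close> also
  \<open>\<bar>f\<bar>\<close> is fixed, because \<open>T\<^sub>t\<close> is positive, and a non-negative fixed vector can be added to \<open>\<phi>\<^sub>0\<close>, whose
  uniqueness as a positive ground state then applies. If the spectrum of \<open>A\<close> avoids \<open>(0, \<delta>)\<close>, then
  \<open>A (A - \<delta>) \<ge> 0\<close> (\<open>gen_spectral_gap\<close>), a fact that is derived here from resolvent estimates at three
  points, without the spectral theorem. Two differential inequalities for \<open>(Q\<^sub>t f, f)\<close> and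
  \<open>(Q\<^sub>t f, A f)\<close> then give \<open>\<parallel>Q\<^sub>t f\<parallel> \<le> e\<^bsup>- \<delta> t\<^esup> \<parallel>f\<parallel>\<close> for \<open>f\<close> orthogonal to \<open>\<phi>\<^sub>0\<close> (\<open>spectral_gap_decay\<close>).
\<close>

section \<open>Symmetric contraction semigroups with a spectral gap\<close>

text \<open>The model is \<open>Q\<^sub>t = e\<^bsup>- t A\<^esup>\<close> for an operator \<open>A \<ge> 0\<close>.\<close>

locale contraction_semigroup =
  fixes Q :: "real \<Rightarrow> 'h::{real_inner, complete_space} \<Rightarrow> 'h"
  assumes lin: "t \<ge> 0 \<Longrightarrow> linear (Q t)"
    and contr: "t \<ge> 0 \<Longrightarrow> norm (Q t f) \<le> norm f"
    and Q_0: "Q 0 f = f"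
    and Q_add: "s \<ge> 0 \<Longrightarrow> t \<ge> 0 \<Longrightarrow> Q (s + t) f = Q s (Q t f)"
    and cont0: "((\<lambda>t. Q t f) \<longlongrightarrow> f) (at_right 0)"
begin

text \<open>The graph of \<open>A\<close>, that is, of minus the infinitesimal generator.\<close>

definition gen :: "('h \<times> 'h) set" where
  "gen = {(f, h). ((\<lambda>t. (f - Q t f) /\<^sub>R t) \<longlongrightarrow> h) (at_right 0)}"

lemma Q_diff: "t \<ge> 0 \<Longrightarrow> Q t (f - g) = Q t f - Q t g"
  using lin linear_diff by blast

lemma Q_scale: "t \<ge> 0 \<Longrightarrow> Q t (c *\<^sub>R f) = c *\<^sub>R Q t f"
  using lin linear_scale by blast

lemma Q_linear_comb: "t \<ge> 0 \<Longrightarrow> Q t (f + g) = Q t f + Q t g"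
  using lin linear_add by blast

lemma gen_add_scaleR:
  assumes "(f, h) \<in> gen" "(g, k) \<in> gen"
  shows "(f + c *\<^sub>R g, h + c *\<^sub>R k) \<in> gen"
proof -
  have "((\<lambda>t. (f - Q t f) /\<^sub>R t + c *\<^sub>R ((g - Q t g) /\<^sub>R t)) \<longlongrightarrow> h + c *\<^sub>R k) (at_right 0)"
    using assms unfolding gen_def mem_Collect_eq prod.case
    by (intro tendsto_add tendsto_scaleR tendsto_const)
  moreover have "\<forall>\<^sub>F t in at_right 0. (f - Q t f) /\<^sub>R t + c *\<^sub>R ((g - Q t g) /\<^sub>R t)
      = ((f + c *\<^sub>R g) - Q t (f + c *\<^sub>R g)) /\<^sub>R t"
    by (rule eventually_at_rightI[of 0 1]) (auto simp: Q_linear_comb Q_scale algebra_simps)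
  ultimately show ?thesis unfolding gen_def by (auto elim: Lim_transform_eventually)
qed

lemma gen_Q:
  assumes "(f, h) \<in> gen" "s \<ge> 0"
  shows "(Q s f, Q s h) \<in> gen"
proof -
  have bl: "bounded_linear (Q s)"
    by (rule bounded_linear_intro[where K=1])
      (use assms(2) in \<open>auto simp: Q_linear_comb Q_scale contr\<close>)
  have "((\<lambda>t. Q s ((f - Q t f) /\<^sub>R t)) \<longlongrightarrow> Q s h) (at_right 0)"
    using assms unfolding gen_def by (auto intro!: bounded_linear.tendsto[OF bl])
  moreover have "\<forall>\<^sub>F t in at_right 0. Q s ((f - Q t f) /\<^sub>R t) = (Q s f - Q t (Q s f)) /\<^sub>R t"
    by (rule eventually_at_rightI[of 0 1])
      (use assms(2) in \<open>auto simp: Q_diff Q_scale Q_add[symmetric] add.commute\<close>)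
  ultimately show ?thesis unfolding gen_def by (auto elim: Lim_transform_eventually)
qed

lemma Q_diff_le:
  assumes "s \<ge> 0" "t \<ge> 0"
  shows "norm (Q t f - Q s f) \<le> norm (Q \<bar>t - s\<bar> f - f)"
proof (cases "s \<le> t")
  case True
  have "Q t f - Q s f = Q s (Q (t - s) f - f)"
    using Q_add[of s "t - s" f] assms True by (simp add: Q_diff)
  then show ?thesis using contr[of s "Q (t - s) f - f"] assms True by simp
next
  case False
  have "Q t f - Q s f = - Q t (Q (s - t) f - f)"
    using Q_add[of t "s - t" f] assms False by (simp add: Q_diff)
  then show ?thesis using contr[of t "Q (s - t) f - f"] assms False by simp
qed

lemma filterlim_abs_diff: "filterlim (\<lambda>y. \<bar>y - t\<bar>) (at_right 0) (at (t::real) within S)"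
  unfolding filterlim_at by (auto intro!: tendsto_eq_intros simp: eventually_at_filter)

lemma Q_continuous: "continuous_on {0..} (\<lambda>t. Q t f)"
  unfolding continuous_on_def
proof
  fix t :: real assume t: "t \<in> {0..}"
  have "((\<lambda>y. norm (Q \<bar>y - t\<bar> f - f)) \<longlongrightarrow> norm (f - f)) (at t within {0..})"
    by (intro tendsto_norm tendsto_diff tendsto_const) (rule filterlim_compose[OF cont0 filterlim_abs_diff])
  then have lim: "((\<lambda>y. norm (Q \<bar>y - t\<bar> f - f)) \<longlongrightarrow> 0) (at t within {0..})"
    by simp
  have "\<forall>\<^sub>F y in at t within {0..}. norm (Q y f - Q t f) \<le> norm (Q \<bar>y - t\<bar> f - f)"
    unfolding eventually_at using t Q_diff_le[of t _ f] by (intro exI[of _ 1]) simp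
  then have "((\<lambda>y. Q y f - Q t f) \<longlongrightarrow> 0) (at t within {0..})"
    using lim by (rule Lim_null_comparison)
  then show "((\<lambda>t. Q t f) \<longlongrightarrow> Q t f) (at t within {0..})"
    by (rule LIM_zero_cancel)
qed

text \<open>Left and right difference quotients are both of the form
  \<open>Q\<^sub>m ((Q\<^sub>s f - f) / s)\<close> with \<open>m = min y t\<close> and \<open>s = \<bar>y - t\<bar>\<close>, so contractivity turns the one-sided
  limit at \<open>0\<close> that defines the generator into a two-sided derivative at \<open>t\<close>.\<close>

lemma Q_deriv:
  assumes fh: "(f, h) \<in> gen" and t: "t > 0"
  shows "((\<lambda>t. Q t f) has_vector_derivative - Q t h) (at t)"
proof -
  let ?e = "\<lambda>s. norm ((f - Q s f) /\<^sub>R s - h) + norm (Q s h - h)"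
  have e0: "(?e \<longlongrightarrow> 0) (at_right 0)"
    using fh cont0[of h] unfolding gen_def
    by (auto intro!: tendsto_add_zero tendsto_norm_zero LIM_zero)
  have lim: "((\<lambda>y. ?e \<bar>y - t\<bar>) \<longlongrightarrow> 0) (at t)"
    by (rule filterlim_compose[OF e0 filterlim_abs_diff])
  have bd: "norm ((Q y f - Q t f) /\<^sub>R (y - t) + Q t h) \<le> ?e \<bar>y - t\<bar>" if y: "y > 0" "y \<noteq> t" for y
  proof -
    define m s where "m = min y t" and "s = \<bar>y - t\<bar>"
    have ms: "m \<ge> 0" "s > 0" "\<bar>t - m\<bar> = 0 \<or> \<bar>t - m\<bar> = s" using t y by (auto simp: m_def s_def)
    have *: "(Q y f - Q t f) /\<^sub>R (y - t) = - Q m ((f - Q s f) /\<^sub>R s)"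
    proof (cases "y > t")
      case True
      then show ?thesis using Q_add[of t "y - t" f] t
        by (simp add: m_def s_def Q_scale Q_diff) (simp add: algebra_simps)
    next
      case False
      with y have yt: "y < t" by simp
      have "inverse (y - t) = - inverse (t - y)"
        by (metis inverse_minus_eq minus_diff_eq)
      then show ?thesis using Q_add[of y "t - y" f] yt y
        by (simp add: m_def s_def Q_scale Q_diff algebra_simps)
    qed
    have "(Q y f - Q t f) /\<^sub>R (y - t) + Q t h = - Q m ((f - Q s f) /\<^sub>R s - h) + (Q t h - Q m h)"
      unfolding * using ms by (simp add: Q_diff)
    also have "norm \<dots> \<le> norm ((f - Q s f) /\<^sub>R s - h) + norm (Q \<bar>t - m\<bar> h - h)"
      using norm_triangle_ineq contr[OF ms(1), of "(f - Q s f) /\<^sub>R s - h"] Q_diff_le[OF ms(1), of t h] t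
      by (smt (verit, best) norm_minus_cancel)
    also have "norm (Q \<bar>t - m\<bar> h - h) \<le> norm (Q s h - h)"
      using ms(3) by (auto simp: Q_0)
    finally show ?thesis by (simp add: s_def)
  qed
  have bl: "bounded_linear (\<lambda>x. x *\<^sub>R - Q t h)"
    by (rule bounded_linear_scaleR_left)
  have "norm (Q y f - Q t f - (y - t) *\<^sub>R - Q t h) / norm (y - t) \<le> ?e \<bar>y - t\<bar>"
    if "y \<noteq> t" "dist y t < t" for y
  proof -
    have "Q y f - Q t f - (y - t) *\<^sub>R - Q t h
        = (y - t) *\<^sub>R ((Q y f - Q t f) /\<^sub>R (y - t) + Q t h)"
      using that(1) by (simp add: scaleR_add_right)
    then have "norm (Q y f - Q t f - (y - t) *\<^sub>R - Q t h) / norm (y - t)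
        = norm ((Q y f - Q t f) /\<^sub>R (y - t) + Q t h)"
      using that(1) by (simp only: norm_scaleR) simp
    then show ?thesis using bd[of y] that by (auto simp: dist_real_def)
  qed
  then show ?thesis unfolding has_vector_derivative_def
    by (intro has_derivativeI_sandwich[OF t bl _ lim]) auto
qed

lemma DERIV_inner_Q:
  assumes "(f, h) \<in> gen" "t > 0"
  shows "DERIV (\<lambda>t. Q t f \<bullet> g) t :> - (Q t h \<bullet> g)"
  using bounded_linear.has_vector_derivative[OF bounded_linear_inner_left Q_deriv[OF assms], of g]
  by (simp add: has_real_derivative_iff_has_vector_derivative)

lemma gen_0_imp_fixed:
  assumes f: "(f, 0) \<in> gen" and t: "t \<ge> 0"
  shows "Q t f = f"
proof (cases "t = 0")
  case False
  with t have t: "t > 0" by simp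
  have Qs0: "Q s 0 = 0" if "s > 0" for s using lin[of s] that linear_0 by force
  have "Q t f \<bullet> g = Q 0 f \<bullet> g" for g
  proof (rule DERIV_isconst_end[OF t, symmetric, THEN sym])
    show "continuous_on {0..t} (\<lambda>t. Q t f \<bullet> g)"
      by (intro continuous_intros continuous_on_subset[OF Q_continuous]) auto
  qed (use DERIV_inner_Q[OF f] Qs0 in auto)
  from this[of "Q t f - f"] have "(Q t f - f) \<bullet> (Q t f - f) = 0"
    by (simp add: Q_0 inner_diff_left)
  then show ?thesis by simp
qed (simp add: Q_0)

lemma fixed_imp_gen_0:
  assumes "\<And>t. t \<ge> 0 \<Longrightarrow> Q t f = f"
  shows "(f, 0) \<in> gen"
proof -
  have "\<forall>\<^sub>F t in at_right 0. 0 = (f - Q t f) /\<^sub>R t"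
    by (rule eventually_at_rightI[of 0 1]) (auto simp: assms)
  then show ?thesis unfolding gen_def by (auto intro: Lim_transform_eventually[OF tendsto_const])
qed

end

text \<open>For \<open>U\<^sub>t = e\<^bsup>- t B\<^esup> f\<close> and \<open>h = B f\<close> this is the generator \<open>B - a\<close> of the rescaled semigroup at \<open>f\<close>: the
  difference quotient of \<open>e\<^bsup>a t\<^esup> U\<^sub>t\<close> is that of \<open>U\<^sub>t\<close> minus \<open>((e\<^bsup>a t\<^esup> - 1) / t) U\<^sub>t\<close>.\<close>

lemma tendsto_generator_rescale:
  fixes U :: "real \<Rightarrow> 'b::real_normed_vector"
  assumes d: "((\<lambda>t. (f - U t) /\<^sub>R t) \<longlongrightarrow> h) (at_right 0)" and c: "(U \<longlongrightarrow> f) (at_right 0)"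
  shows "((\<lambda>t. (f - exp (a * t) *\<^sub>R U t) /\<^sub>R t) \<longlongrightarrow> h - a *\<^sub>R f) (at_right 0)"
proof -
  have "((\<lambda>t. exp (a * t)) has_real_derivative a) (at 0)"
    by (auto intro!: derivative_eq_intros)
  then have "((\<lambda>t. (exp (a * t) - 1) / t) \<longlongrightarrow> a) (at 0)"
    by (simp add: has_field_derivative_iff)
  then have e: "((\<lambda>t. (exp (a * t) - 1) / t) \<longlongrightarrow> a) (at_right 0)"
    by (rule tendsto_within_subset) simp
  have "((\<lambda>t. (f - U t) /\<^sub>R t - ((exp (a * t) - 1) / t) *\<^sub>R U t) \<longlongrightarrow> h - a *\<^sub>R f) (at_right 0)"
    by (intro tendsto_diff tendsto_scaleR d c e)
  moreover have "\<forall>\<^sub>F t in at_right 0. (f - U t) /\<^sub>R t - ((exp (a * t) - 1) / t) *\<^sub>R U t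
      = (f - exp (a * t) *\<^sub>R U t) /\<^sub>R t"
    by (rule eventually_at_rightI[of 0 1]) (auto simp: algebra_simps divide_inverse)
  ultimately show ?thesis by (rule Lim_transform_eventually)
qed

text \<open>Symmetry is only demanded of the generator; it passes to \<open>Q\<^sub>t\<close> because
  \<open>s \<mapsto> (Q\<^bsub>t-s\<^esub> f, Q\<^sub>s g)\<close> has derivative zero for \<open>f\<close>, \<open>g\<close> in the domain.\<close>

locale symmetric_contraction_semigroup = contraction_semigroup +
  assumes gen_symmetric: "(f, h) \<in> gen \<Longrightarrow> (g, k) \<in> gen \<Longrightarrow> f \<bullet> k = h \<bullet> g"
    and gen_dense: "\<epsilon> > 0 \<Longrightarrow> \<exists>g k. (g, k) \<in> gen \<and> norm (g - f) < \<epsilon>"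
begin

lemma dense_sequence:
  obtains g k where "\<And>n. (g n, k n) \<in> gen" "g \<longlonglongrightarrow> f"
proof -
  have "\<exists>g k. (g, k) \<in> gen \<and> norm (g - f) < 1 / Suc n" for n
    by (rule gen_dense) simp
  then obtain g k where *: "\<And>n. (g n, k n) \<in> gen" "\<And>n. norm (g n - f) < 1 / Suc n"
    by metis
  have "(\<lambda>n. g n - f) \<longlonglongrightarrow> 0"
    by (rule Lim_null_comparison[OF _ LIMSEQ_Suc[OF lim_inverse_n']])
      (use *(2) in \<open>auto intro!: always_eventually less_imp_le\<close>)
  then have "g \<longlonglongrightarrow> f" by (rule LIM_zero_cancel)
  with *(1) show thesis by (rule that)
qed

lemma Q_tendsto:
  assumes "g \<longlonglongrightarrow> f" "t \<ge> 0"
  shows "(\<lambda>n. Q t (g n)) \<longlonglongrightarrow> Q t f"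
proof -
  have "bounded_linear (Q t)"
    by (rule bounded_linear_intro[where K=1])
      (use assms(2) in \<open>auto simp: Q_linear_comb Q_scale contr\<close>)
  then show ?thesis using assms(1) by (rule bounded_linear.tendsto)
qed

lemma Q_symmetric_gen:
  assumes fh: "(f, h) \<in> gen" and gk: "(g, k) \<in> gen" and t: "t \<ge> 0"
  shows "Q t f \<bullet> g = f \<bullet> Q t g"
proof (cases "t = 0")
  case False
  with t have t: "t > 0" by simp
  let ?F = "\<lambda>s. Q (t - s) f \<bullet> Q s g"
  have "?F t = ?F 0"
  proof (rule DERIV_isconst_end[OF t])
    have "continuous_on {0..t} (\<lambda>s. Q (t - s) f)"
      by (rule continuous_on_compose2[OF Q_continuous]) (auto intro!: continuous_intros)
    then show "continuous_on {0..t} ?F"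
      by (intro continuous_on_inner continuous_on_subset[OF Q_continuous]) auto
  next
    fix s assume s: "0 < s" "s < t"
    have ga: "(Q (t - s) f, Q (t - s) h) \<in> gen" "(Q s g, Q s k) \<in> gen"
      using s fh gk by (auto intro!: gen_Q)
    have d0: "((\<lambda>s. t - s) has_real_derivative -1) (at s)"
      by (auto intro!: derivative_eq_intros)
    have "((\<lambda>t. Q t f) has_vector_derivative - Q (t - s) h) (at (t - s))"
      by (rule Q_deriv[OF fh]) (use s in simp)
    then have d1: "((\<lambda>s. Q (t - s) f) has_vector_derivative Q (t - s) h) (at s)"
      using vector_diff_chain_at[OF d0[unfolded has_real_derivative_iff_has_vector_derivative],
        of "\<lambda>t. Q t f" "- Q (t - s) h"] by (simp add: o_def)
    have d2: "((\<lambda>s. Q s g) has_vector_derivative - Q s k) (at s)"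
      by (rule Q_deriv[OF gk s(1)])
    have "(?F has_vector_derivative
        (Q (t - s) f \<bullet> (- Q s k) + Q (t - s) h \<bullet> Q s g)) (at s)"
      using bounded_bilinear.has_vector_derivative[OF bounded_bilinear_inner d1 d2] .
    then show "DERIV ?F s :> 0"
      using gen_symmetric[OF ga] by (simp add: has_real_derivative_iff_has_vector_derivative)
  qed
  then show ?thesis by (simp add: Q_0)
qed (simp add: Q_0)

lemma Q_symmetric:
  assumes t: "t \<ge> 0"
  shows "Q t f \<bullet> g = f \<bullet> Q t g"
proof -
  obtain F F' where F: "\<And>n. (F n, F' n) \<in> gen" "F \<longlonglongrightarrow> f"
    using dense_sequence[of f] by blast
  obtain G G' where G: "\<And>n. (G n, G' n) \<in> gen" "G \<longlonglongrightarrow> g"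
    using dense_sequence[of g] by blast
  have "(\<lambda>n. Q t (F n) \<bullet> G n) \<longlonglongrightarrow> Q t f \<bullet> g"
    by (intro tendsto_inner Q_tendsto F G t)
  moreover have "(\<lambda>n. F n \<bullet> Q t (G n)) \<longlonglongrightarrow> f \<bullet> Q t g"
    by (intro tendsto_inner Q_tendsto F G t)
  ultimately show ?thesis
    using LIMSEQ_unique Q_symmetric_gen[OF F(1) G(1) t] by auto
qed

lemma Q_half: "t \<ge> 0 \<Longrightarrow> Q t f \<bullet> g = Q (t / 2) f \<bullet> Q (t / 2) g"
  using Q_add[of "t / 2" "t / 2" f] Q_symmetric[of "t / 2"] by simp

lemma gen_nonneg:
  assumes "(f, h) \<in> gen"
  shows "h \<bullet> f \<ge> 0"
proof (rule tendsto_lowerbound)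
  show "((\<lambda>t. ((f - Q t f) /\<^sub>R t) \<bullet> f) \<longlongrightarrow> h \<bullet> f) (at_right 0)"
    using assms unfolding gen_def mem_Collect_eq prod.case by (intro tendsto_inner tendsto_const)
  have "((f - Q t f) /\<^sub>R t) \<bullet> f \<ge> 0" if "t > 0" for t
  proof -
    have "Q t f \<bullet> f \<le> norm f * norm f"
      using norm_cauchy_schwarz[of "Q t f" f] contr[of t f] that
      by (smt (verit) mult_right_mono norm_ge_zero)
    then have "(f - Q t f) \<bullet> f \<ge> 0"
      by (simp add: inner_diff_left dot_square_norm power2_eq_square)
    then show ?thesis using that by simp
  qed
  then show "\<forall>\<^sub>F t in at_right 0. 0 \<le> ((f - Q t f) /\<^sub>R t) \<bullet> f"
    by (intro eventually_at_rightI[of 0 1]) auto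
qed simp

definition resolvent_at :: "real \<Rightarrow> bool" where
  "resolvent_at \<mu> \<longleftrightarrow> (\<forall>g. \<exists>f h. (f, h) \<in> gen \<and> h - \<mu> *\<^sub>R f = g) \<and>
     (\<exists>C. \<forall>(f, h)\<in>gen. norm f \<le> C * norm (h - \<mu> *\<^sub>R f))"

text \<open>The last assumption says \<open>r \<le> 1 / \<parallel>R\<parallel>\<close> for the resolvent \<open>R = (A - \<mu>)\<^sup>-\<^sup>1\<close>. Since \<open>R\<close> is symmetric,
  \<open>\<parallel>(1 - r\<^sup>2 R\<^sup>2) g\<parallel>\<^sup>2 \<le> \<parallel>g\<parallel>\<^sup>2 - r\<^sup>2 \<parallel>R g\<parallel>\<^sup>2\<close>, which for \<open>r = 1 / \<parallel>R\<parallel>\<close> is small when \<open>g\<close> almost attains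
  the norm of \<open>R\<close>.
  On the other hand \<open>1 - r\<^sup>2 R\<^sup>2 = (A - \<mu> - r) (A - \<mu> + r) R\<^sup>2\<close>, and both factors are bounded below if
  \<open>\<mu> \<plusminus> r\<close> are in the resolvent set. The two facts are combined into one inequality between
  \<open>f = R g\<close> and \<open>g = h - \<mu> f\<close>.\<close>

lemma resolvent_bound:
  assumes mu: "resolvent_at \<mu>" "resolvent_at (\<mu> - r)" "resolvent_at (\<mu> + r)" and r: "r > 0"
    and rho: "\<And>f h. (f, h) \<in> gen \<Longrightarrow> r * norm f \<le> norm (h - \<mu> *\<^sub>R f)"
  obtains C where "C \<ge> 0" "\<And>f h. (f, h) \<in> gen \<Longrightarrow>
     norm f ^ 4 \<le> C * norm (h - \<mu> *\<^sub>R f) ^ 2 * (norm (h - \<mu> *\<^sub>R f) ^ 2 - r\<^sup>2 * norm f ^ 2)"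
proof -
  obtain C1 where C1: "\<And>f h. (f, h) \<in> gen \<Longrightarrow> norm f \<le> C1 * norm (h - (\<mu> - r) *\<^sub>R f)"
    using mu(2) unfolding resolvent_at_def by blast
  obtain C2 where C2: "\<And>f h. (f, h) \<in> gen \<Longrightarrow> norm f \<le> C2 * norm (h - (\<mu> + r) *\<^sub>R f)"
    using mu(3) unfolding resolvent_at_def by blast
  define C where "C = (\<bar>C1\<bar> * \<bar>C2\<bar>)\<^sup>2"
  have "norm f ^ 4 \<le> C * norm (h - \<mu> *\<^sub>R f) ^ 2 * (norm (h - \<mu> *\<^sub>R f) ^ 2 - r\<^sup>2 * norm f ^ 2)"
    if fh: "(f, h) \<in> gen" for f h
  proof -
    define g where "g = h - \<mu> *\<^sub>R f"
    obtain f2 h2 where f2: "(f2, h2) \<in> gen" "h2 - \<mu> *\<^sub>R f2 = f"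
      using mu(1) unfolding resolvent_at_def by blast
    have h: "h = g + \<mu> *\<^sub>R f" and h2: "h2 = f + \<mu> *\<^sub>R f2"
      using f2(2) by (auto simp: g_def algebra_simps)
    have ff: "f \<bullet> f = f2 \<bullet> g"
      using gen_symmetric[OF fh f2(1)] by (simp add: h h2 inner_simps inner_commute)
    have "norm f2 \<le> \<bar>C1\<bar> * norm (f + r *\<^sub>R f2)"
    proof -
      have "h2 - (\<mu> - r) *\<^sub>R f2 = f + r *\<^sub>R f2" by (simp add: h2 algebra_simps)
      then have "norm f2 \<le> C1 * norm (f + r *\<^sub>R f2)" using C1[OF f2(1)] by simp
      also have "\<dots> \<le> \<bar>C1\<bar> * norm (f + r *\<^sub>R f2)" by (intro mult_right_mono) auto
      finally show ?thesis .
    qed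
    also have "norm (f + r *\<^sub>R f2) \<le> \<bar>C2\<bar> * norm (g - r\<^sup>2 *\<^sub>R f2)"
    proof -
      have "h + r *\<^sub>R h2 - (\<mu> + r) *\<^sub>R (f + r *\<^sub>R f2) = g - r\<^sup>2 *\<^sub>R f2"
        by (simp add: h h2 algebra_simps power2_eq_square)
      then have "norm (f + r *\<^sub>R f2) \<le> C2 * norm (g - r\<^sup>2 *\<^sub>R f2)"
        using C2[OF gen_add_scaleR[OF fh f2(1), of r]] by simp
      also have "\<dots> \<le> \<bar>C2\<bar> * norm (g - r\<^sup>2 *\<^sub>R f2)"
        by (intro mult_right_mono) auto
      finally show ?thesis .
    qed
    finally have f2_le: "norm f2 \<le> \<bar>C1\<bar> * \<bar>C2\<bar> * norm (g - r\<^sup>2 *\<^sub>R f2)"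
      by (simp add: mult_left_mono mult.assoc)
    have f2_bd: "norm f2 ^ 2 \<le> C * norm (g - r\<^sup>2 *\<^sub>R f2) ^ 2"
      using power_mono[OF f2_le norm_ge_zero, of 2] by (simp add: C_def power_mult_distrib)
    have "norm (g - r\<^sup>2 *\<^sub>R f2) ^ 2 = norm g ^ 2 - 2 * r\<^sup>2 * norm f ^ 2 + r\<^sup>2 * (r * norm f2)\<^sup>2"
      unfolding power_mult_distrib power2_norm_eq_inner ff
      by (simp add: inner_simps inner_commute power2_eq_square algebra_simps)
    also have "(r * norm f2)\<^sup>2 \<le> norm f ^ 2"
      using rho[OF f2(1)] f2(2) r by (intro power_mono) auto
    finally have up: "norm (g - r\<^sup>2 *\<^sub>R f2) ^ 2 \<le> norm g ^ 2 - r\<^sup>2 * norm f ^ 2"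
      using r by (simp add: mult_left_mono)
    have "norm f ^ 2 \<le> norm f2 * norm g"
      using ff norm_cauchy_schwarz[of f2 g] by (simp add: power2_norm_eq_inner)
    then have "norm f ^ 4 \<le> norm f2 ^ 2 * norm g ^ 2"
      using power_mono[of "norm f ^ 2" "norm f2 * norm g" 2] by (simp add: power_mult_distrib flip: power_mult)
    also have "\<dots> \<le> (C * (norm g ^ 2 - r\<^sup>2 * norm f ^ 2)) * norm g ^ 2"
    proof (intro mult_right_mono)
      have "C * norm (g - r\<^sup>2 *\<^sub>R f2) ^ 2 \<le> C * (norm g ^ 2 - r\<^sup>2 * norm f ^ 2)"
        using up by (intro mult_left_mono) (auto simp: C_def)
      then show "norm f2 ^ 2 \<le> C * (norm g ^ 2 - r\<^sup>2 * norm f ^ 2)" using f2_bd by simp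
    qed simp
    finally show ?thesis by (simp add: g_def mult_ac)
  qed
  then show thesis using that[of C] by (simp add: C_def)
qed

text \<open>The norm of the resolvent at the midpoint of the gap is at most the reciprocal of the distance
  to its ends. If \<open>\<parallel>R\<parallel>\<close> were larger, then \<open>\<mu> \<plusminus> 1 / \<parallel>R\<parallel>\<close> would both lie inside the gap, and the previous
  lemma, applied along a sequence that attains the norm of \<open>R\<close> in the limit, would give \<open>\<parallel>R\<parallel>\<^sup>4 \<le> 0\<close>.\<close>

lemma norm_resolvent_gap:
  assumes gap: "\<And>\<mu>. 0 < \<mu> \<Longrightarrow> \<mu> < \<delta> \<Longrightarrow> resolvent_at \<mu>" and fh: "(f0, h0) \<in> gen" and d: "\<delta> > 0"
  shows "\<delta> / 2 * norm f0 \<le> norm (h0 - (\<delta> / 2) *\<^sub>R f0)"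
proof (rule ccontr)
  define \<mu> where "\<mu> = \<delta> / 2"
  have mu: "0 < \<mu>" "resolvent_at \<mu>" using d gap[of \<mu>] by (auto simp: \<mu>_def)
  assume "\<not> ?thesis"
  then have less: "norm (h0 - \<mu> *\<^sub>R f0) < \<mu> * norm f0" by (simp add: \<mu>_def)
  obtain C where C: "\<And>f h. (f, h) \<in> gen \<Longrightarrow> norm f \<le> C * norm (h - \<mu> *\<^sub>R f)"
    using mu(2) unfolding resolvent_at_def by blast
  have pos: "norm (h - \<mu> *\<^sub>R f) > 0" if "(f, h) \<in> gen" "f \<noteq> 0" for f h
    using C[OF that(1)] that(2) by (cases "h - \<mu> *\<^sub>R f = 0") auto
  define S where "S = {norm f / norm (h - \<mu> *\<^sub>R f) | f h. (f, h) \<in> gen \<and> f \<noteq> 0}"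
  define \<rho> where "\<rho> = Sup S"
  have bdd: "bdd_above S"
    by (rule bdd_aboveI[of _ C]) (use C pos in \<open>auto simp: S_def divide_le_eq\<close>)
  have f0: "f0 \<noteq> 0" using less by auto
  have in_S: "norm f0 / norm (h0 - \<mu> *\<^sub>R f0) \<in> S" using fh f0 by (auto simp: S_def)
  have "1 / \<mu> < norm f0 / norm (h0 - \<mu> *\<^sub>R f0)"
    using less pos[OF fh f0] mu by (simp add: field_simps)
  also have "\<dots> \<le> \<rho>" unfolding \<rho>_def by (rule cSup_upper[OF in_S bdd])
  finally have rho: "1 / \<mu> < \<rho>" .
  have rho_pos: "\<rho> > 0" using rho mu less_trans[of 0 "1 / \<mu>"] by simp
  define r where "r = 1 / \<rho>"
  have r: "0 < r" "r < \<mu>" using rho rho_pos mu by (auto simp: r_def field_simps)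
  have rho_bd: "r * norm f \<le> norm (h - \<mu> *\<^sub>R f)" if "(f, h) \<in> gen" for f h
  proof (cases "f = 0")
    case False
    have "norm f / norm (h - \<mu> *\<^sub>R f) \<le> \<rho>"
      unfolding \<rho>_def using that False by (intro cSup_upper[OF _ bdd]) (auto simp: S_def)
    then show ?thesis using pos[OF that False] rho_pos by (simp add: r_def field_simps)
  qed simp
  have res: "resolvent_at (\<mu> - r)" "resolvent_at (\<mu> + r)"
    using r by (auto intro!: gap simp: \<mu>_def)
  obtain D where D: "D \<ge> 0" "\<And>f h. (f, h) \<in> gen \<Longrightarrow>
     norm f ^ 4 \<le> D * norm (h - \<mu> *\<^sub>R f) ^ 2 * (norm (h - \<mu> *\<^sub>R f) ^ 2 - r\<^sup>2 * norm f ^ 2)"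
    by (rule resolvent_bound[OF mu(2) res r(1) rho_bd]) auto
  have "S \<subseteq> {q. q ^ 4 \<le> D * (1 - r\<^sup>2 * q\<^sup>2)}"
  proof (clarsimp simp: S_def)
    fix f h assume fh: "(f, h) \<in> gen" and f: "f \<noteq> 0"
    let ?g = "norm (h - \<mu> *\<^sub>R f)"
    have "norm f ^ 4 / ?g ^ 4 \<le> (D * ?g\<^sup>2 * (?g\<^sup>2 - r\<^sup>2 * (norm f)\<^sup>2)) / ?g ^ 4"
      by (intro divide_right_mono D(2) fh) simp
    also have "\<dots> = D * (1 - r\<^sup>2 * (norm f / ?g)\<^sup>2)"
      using pos[OF fh f] by (simp add: field_simps power2_eq_square power4_eq_xxxx)
    finally show "(norm f / ?g) ^ 4 \<le> D * (1 - r\<^sup>2 * (norm f / ?g)\<^sup>2)"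
      by (simp add: power_divide)
  qed
  moreover have "closed {q :: real. q ^ 4 \<le> D * (1 - r\<^sup>2 * q\<^sup>2)}"
    by (intro closed_Collect_le continuous_intros)
  ultimately have "\<rho> \<in> {q. q ^ 4 \<le> D * (1 - r\<^sup>2 * q\<^sup>2)}"
    unfolding \<rho>_def using closed_subset_contains_Sup[of _ S] in_S bdd by blast
  then have "\<rho> ^ 4 \<le> 0" using rho_pos by (simp add: r_def power_divide)
  then show False using rho_pos by (meson not_le zero_less_power)
qed

text \<open>This is the operator inequality \<open>A (A - \<delta>) \<ge> 0\<close>, which expresses that the spectrum avoids
  \<open>(0, \<delta>)\<close>; squaring the preceding bound gives it.\<close>

lemma gen_spectral_gap:
  assumes gap: "\<And>\<mu>. 0 < \<mu> \<Longrightarrow> \<mu> < \<delta> \<Longrightarrow> resolvent_at \<mu>" and fh: "(f, h) \<in> gen" and d: "\<delta> > 0"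
  shows "\<delta> * (h \<bullet> f) \<le> h \<bullet> h"
proof -
  have "(\<delta> / 2 * norm f)\<^sup>2 \<le> (norm (h - (\<delta> / 2) *\<^sub>R f))\<^sup>2"
    by (intro power_mono norm_resolvent_gap[OF gap fh]) (use d in auto)
  also have "\<dots> = h \<bullet> h - \<delta> * (h \<bullet> f) + (\<delta> / 2 * norm f)\<^sup>2"
    unfolding power_mult_distrib power2_norm_eq_inner
    by (simp add: inner_simps inner_commute algebra_simps power2_eq_square)
  finally show ?thesis by simp
qed

text \<open>With \<open>u(t) = (Q\<^sub>t f, f) = \<parallel>Q\<^bsub>t/2\<^esub> f\<parallel>\<^sup>2\<close>, which decreases to a limit, one has
  \<open>\<parallel>Q\<^sub>m f - Q\<^sub>n f\<parallel>\<^sup>2 = u(2m) - 2 u(m+n) + u(2n)\<close>, so \<open>Q\<^sub>n f\<close> is a Cauchy sequence.\<close>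

lemma Q_converges:
  obtains l where "(\<lambda>n. Q (real n) f) \<longlonglongrightarrow> l" "\<And>t. t \<ge> 0 \<Longrightarrow> Q t l = l"
proof -
  define u where "u t = Q t f \<bullet> f" for t
  have u_nonneg: "u t \<ge> 0" if "t \<ge> 0" for t
    using Q_half[OF that, of f f] by (simp add: u_def)
  have u_norm: "u (2 * t) = (norm (Q t f))\<^sup>2" if "t \<ge> 0" for t
    using Q_half[of "2 * t" f f] that by (simp add: u_def power2_norm_eq_inner)
  have dec: "decseq (\<lambda>n. u (real n))"
  proof (rule decseq_SucI)
    fix n
    have "Q (real (Suc n) / 2) f = Q (1 / 2) (Q (real n / 2) f)"
      using Q_add[of "1 / 2" "real n / 2" f] by (simp add: add_divide_distrib)
    then have "norm (Q (real (Suc n) / 2) f) \<le> norm (Q (real n / 2) f)"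
      using contr[of "1 / 2"] by simp
    then have "(norm (Q (real (Suc n) / 2) f))\<^sup>2 \<le> (norm (Q (real n / 2) f))\<^sup>2"
      by (intro power_mono) auto
    also have "(norm (Q (real (Suc n) / 2) f))\<^sup>2 = u (real (Suc n))"
      using u_norm[of "real (Suc n) / 2"] unfolding times_divide_eq_right nonzero_mult_div_cancel_left[OF zero_neq_numeral[symmetric]] by simp
    also have "(norm (Q (real n / 2) f))\<^sup>2 = u (real n)"
      using u_norm[of "real n / 2"] by simp
    finally show "u (real (Suc n)) \<le> u (real n)" .
  qed
  obtain L where L: "(\<lambda>n. u (real n)) \<longlonglongrightarrow> L"
    by (rule decseq_convergent[OF dec, of 0]) (simp_all add: u_nonneg)
  have Cauchy: "Cauchy (\<lambda>n. Q (real n) f)"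
  proof (rule metric_CauchyI)
    fix e :: real assume e: "e > 0"
    obtain N where N: "\<And>n. n \<ge> N \<Longrightarrow> \<bar>u (real n) - L\<bar> < e\<^sup>2 / 4"
      using L e unfolding LIMSEQ_def dist_real_def by (metis divide_pos_pos zero_less_numeral zero_less_power)
    have "dist (Q (real m) f) (Q (real n) f) < e" if "m \<ge> N" "n \<ge> N" for m n
    proof -
      have mn: "Q (real m) f \<bullet> Q (real n) f = u (real (m + n))" for m n
        using Q_symmetric[of "real n" "Q (real m) f" f] Q_add[of "real n" "real m" f]
        by (simp add: u_def add.commute)
      have "(dist (Q (real m) f) (Q (real n) f))\<^sup>2
          = u (real (m + m)) - 2 * u (real (m + n)) + u (real (n + n))"
        unfolding dist_norm power2_norm_eq_inner by (simp add: inner_simps mn add.commute)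
      also have "\<dots> < e\<^sup>2"
        using N[of "m + m"] N[of "m + n"] N[of "n + n"] that by linarith
      finally show ?thesis using e by (simp add: power_less_imp_less_base)
    qed
    then show "\<exists>M. \<forall>m\<ge>M. \<forall>n\<ge>M. dist (Q (real m) f) (Q (real n) f) < e" by blast
  qed
  then obtain l where l: "(\<lambda>n. Q (real n) f) \<longlonglongrightarrow> l"
    using Cauchy_convergent_iff convergent_def by blast
  have fixed_nat: "Q (real n) l = l" for n
  proof (rule LIMSEQ_unique)
    show "(\<lambda>m. Q (real n) (Q (real m) f)) \<longlonglongrightarrow> Q (real n) l"
      by (rule Q_tendsto[OF l]) simp
    show "(\<lambda>m. Q (real n) (Q (real m) f)) \<longlonglongrightarrow> l"
      using LIMSEQ_ignore_initial_segment[OF l, of n] Q_add[of "real n" _ f]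
      by (simp add: add.commute)
  qed
  \<comment> \<open>The limit is fixed at integer times; in between, the norm of \<open>Q\<^sub>s l\<close> is squeezed, and equality in the Cauchy--Schwarz inequality for \<open>(Q\<^sub>t l, l)\<close> forces \<open>Q\<^sub>t l = l\<close>.\<close>
  have norm_l: "norm (Q s l) = norm l" if s: "s \<ge> 0" for s
  proof (rule antisym)
    define n where "n = nat \<lceil>s\<rceil>"
    have n: "s \<le> real n" unfolding n_def by linarith
    then have "norm l \<le> norm (Q s l)"
      using fixed_nat[of n] Q_add[of "real n - s" s l] contr[of "real n - s" "Q s l"] s by simp
    then show "norm l \<le> norm (Q s l)" .
  qed (rule contr[OF s])
  have "Q t l = l" if t: "t \<ge> 0" for t
  proof -
    have "Q t l \<bullet> l = l \<bullet> l"
      using Q_half[of t l l] norm_l[of "t / 2"] t by (simp add: norm_eq)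
    then have "(Q t l - l) \<bullet> (Q t l - l) = 0"
      using norm_l[OF t] by (simp add: inner_simps inner_commute norm_eq)
    then show ?thesis by simp
  qed
  then show thesis using that l by blast
qed

text \<open>For \<open>f\<close> in the domain put \<open>u(t) = (Q\<^sub>t f, f)\<close> and \<open>a(t) = (Q\<^sub>t f, A f)\<close>. Then \<open>u' = - a\<close>, and
  \<open>a' \<le> - \<delta> a\<close> by the gap inequality, so \<open>a - \<delta> u\<close> is non-increasing. As \<open>f\<close> is orthogonal to the
  fixed vectors, \<open>u\<close> tends to \<open>0\<close>; hence \<open>a \<ge> \<delta> u\<close>, that is, \<open>u' \<le> - \<delta> u\<close>. Density of the domain does
  the rest.\<close>

theorem spectral_gap_decay:
  assumes gap: "\<And>\<mu>. 0 < \<mu> \<Longrightarrow> \<mu> < \<delta> \<Longrightarrow> resolvent_at \<mu>" and d: "\<delta> > 0"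
    and ker: "\<And>g. (\<And>t. t \<ge> 0 \<Longrightarrow> Q t g = g) \<Longrightarrow> \<exists>c. g = c *\<^sub>R \<phi>"
    and fixed: "\<And>t. t \<ge> 0 \<Longrightarrow> Q t \<phi> = \<phi>" and norm_phi: "norm \<phi> = 1"
    and orth: "f \<bullet> \<phi> = 0" and t: "t \<ge> 0"
  shows "norm (Q t f) \<le> exp (- \<delta> * t) * norm f"
proof -
  have limit0: "(\<lambda>n. Q (real n) f) \<longlonglongrightarrow> 0" if "f \<bullet> \<phi> = 0" for f
  proof -
    obtain l where l: "(\<lambda>n. Q (real n) f) \<longlonglongrightarrow> l" "\<And>t. t \<ge> 0 \<Longrightarrow> Q t l = l"
      using Q_converges by blast
    obtain c where c: "l = c *\<^sub>R \<phi>" using ker l(2) by blast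
    have "(\<lambda>n. Q (real n) f \<bullet> \<phi>) \<longlonglongrightarrow> l \<bullet> \<phi>"
      by (intro tendsto_inner l tendsto_const)
    then have "l \<bullet> \<phi> = 0"
      using that Q_symmetric[of "real _" f \<phi>] by (simp add: fixed LIMSEQ_const_iff)
    then have "l \<bullet> l = 0" by (subst (2) c) simp
    with l(1) show ?thesis by simp
  qed
  have decay: "norm (Q t f) \<le> exp (- \<delta> * t) * norm f"
    if fh: "(f, h) \<in> gen" and orth: "f \<bullet> \<phi> = 0" for f h
  proof -
    define u where "u t = Q t f \<bullet> f" for t
    define a where "a t = Q t f \<bullet> h" for t
    have a_eq: "a t = Q t h \<bullet> f" if "t \<ge> 0" for t
      using Q_symmetric[OF that, of f h] by (simp add: a_def inner_commute)
    have a_nonneg: "a t \<ge> 0" if "t \<ge> 0" for t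
      using gen_nonneg[OF gen_Q[OF fh, of "t / 2"]] that Q_half[OF that, of h f] by (simp add: a_eq)
    have du: "DERIV u t :> - a t" if "t > 0" for t
      using DERIV_inner_Q[OF fh that, of f] that a_eq[of t] by (simp add: u_def[abs_def])
    have da: "DERIV a t :> - (Q t h \<bullet> h)" if "t > 0" for t
      using DERIV_inner_Q[OF fh that, of h] by (simp add: a_def[abs_def])
    have cont: "continuous_on {x..y} u" "continuous_on {x..y} a" if "x \<ge> 0" for x y
      unfolding u_def[abs_def] a_def[abs_def] using that
      by (auto intro!: continuous_intros continuous_on_subset[OF Q_continuous])
    have au: "\<delta> * u x \<le> a x" if x: "x \<ge> 0" for x
    proof -
      have mono: "a y - \<delta> * u y \<le> a x - \<delta> * u x" if xy: "x \<le> y" for y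
      proof (cases "x = y")
        case False
        have "- a x + \<delta> * u x \<le> - a y + \<delta> * u y"
        proof (rule DERIV_nonneg_imp_increasing_open[OF xy])
          fix z assume z: "x < z" "z < y"
          have "\<delta> * (Q (z / 2) h \<bullet> Q (z / 2) f) \<le> Q (z / 2) h \<bullet> Q (z / 2) h"
            by (rule gen_spectral_gap[OF gap gen_Q[OF fh] d]) (use z x in auto)
          then have "0 \<le> Q z h \<bullet> h - \<delta> * a z"
            using z x Q_half[of z h h] Q_half[of z h f] by (simp add: a_eq)
          moreover have "DERIV (\<lambda>z. - a z + \<delta> * u z) z :> Q z h \<bullet> h - \<delta> * a z"
            by (rule derivative_eq_intros da du refl | use z x in simp)+
          ultimately show "\<exists>y. DERIV (\<lambda>z. - a z + \<delta> * u z) z :> y \<and> y \<ge> 0" by blast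
        qed (intro continuous_intros cont x)
        then show ?thesis by simp
      qed simp
      have ge: "- (\<delta> * u (real n)) \<le> a x - \<delta> * u x" if "real n \<ge> x" for n
        using mono[OF that] a_nonneg[of "real n"] by simp
      have ev: "\<forall>\<^sub>F n in sequentially. - (\<delta> * u (real n)) \<le> a x - \<delta> * u x"
      proof (rule eventually_sequentiallyI[of "nat \<lceil>x\<rceil>"])
        fix n assume "nat \<lceil>x\<rceil> \<le> n"
        then have "x \<le> real n" by linarith
        then show "- (\<delta> * u (real n)) \<le> a x - \<delta> * u x" by (rule ge)
      qed
      have "(\<lambda>n. - (\<delta> * u (real n))) \<longlonglongrightarrow> - (\<delta> * (0 \<bullet> f))"
        unfolding u_def by (intro tendsto_minus tendsto_mult tendsto_inner tendsto_const limit0 orth)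
      then have "- (\<delta> * (0 \<bullet> f)) \<le> a x - \<delta> * u x"
        by (rule tendsto_upperbound[OF _ ev]) simp
      then show ?thesis by simp
    qed
    have "exp (\<delta> * x) * u x \<le> exp (\<delta> * 0) * u 0" if x: "x \<ge> 0" for x
    proof -
      have "- (exp (\<delta> * 0) * u 0) \<le> - (exp (\<delta> * x) * u x)"
      proof (rule DERIV_nonneg_imp_increasing_open[OF x])
        fix z assume z: "0 < z" "z < x"
        have "DERIV (\<lambda>z. - (exp (\<delta> * z) * u z)) z :> exp (\<delta> * z) * (a z - \<delta> * u z)"
          by (rule derivative_eq_intros du refl | use z in \<open>simp add: algebra_simps\<close>)+
        moreover have "exp (\<delta> * z) * (a z - \<delta> * u z) \<ge> 0"
          using au[of z] z by simp
        ultimately show "\<exists>y. DERIV (\<lambda>z. - (exp (\<delta> * z) * u z)) z :> y \<and> y \<ge> 0" by blast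
      qed (auto intro!: continuous_intros cont)
      then show ?thesis by simp
    qed
    from this[of "2 * t"] have le: "exp (\<delta> * (2 * t)) * u (2 * t) \<le> u 0"
      using t by simp
    have "u (2 * t) = (norm (Q t f))\<^sup>2" "u 0 = (norm f)\<^sup>2"
      using t Q_half[of "2 * t" f f] by (simp_all add: u_def Q_0 power2_norm_eq_inner)
    moreover have "exp (\<delta> * (2 * t)) = (exp (\<delta> * t))\<^sup>2"
      using exp_double[of "\<delta> * t"] by (simp only: mult.left_commute)
    ultimately have "exp (\<delta> * t) ^ 2 * norm (Q t f) ^ 2 \<le> norm f ^ 2"
      using le by simp
    then have "(exp (\<delta> * t) * norm (Q t f))\<^sup>2 \<le> (norm f)\<^sup>2"
      by (simp only: power_mult_distrib)
    then have "exp (\<delta> * t) * norm (Q t f) \<le> norm f"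
      by (rule power2_le_imp_le) simp
    then have "exp (- (\<delta> * t)) * (exp (\<delta> * t) * norm (Q t f)) \<le> exp (- (\<delta> * t)) * norm f"
      by (rule mult_left_mono) simp
    moreover have "exp (- (\<delta> * t)) * exp (\<delta> * t) = 1"
      by (simp flip: exp_add)
    ultimately show ?thesis by (simp only: mult.assoc[symmetric] minus_mult_left mult_1)
  qed
  obtain F F' where F: "\<And>n. (F n, F' n) \<in> gen" "F \<longlonglongrightarrow> f"
    using dense_sequence[of f] by blast
  \<comment> \<open>The approximating vectors are projected to the orthogonal complement of \<open>\<phi>\<close>, which keeps them in the domain.\<close>
  define G where "G n = F n + (- (F n \<bullet> \<phi>)) *\<^sub>R \<phi>" for n
  have phi_gen: "(\<phi>, 0) \<in> gen" by (rule fixed_imp_gen_0[OF fixed])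
  have G_gen: "(G n, F' n) \<in> gen" for n
    using gen_add_scaleR[OF F(1) phi_gen, of n "- (F n \<bullet> \<phi>)"] by (simp add: G_def)
  have G_orth: "G n \<bullet> \<phi> = 0" for n
    using norm_phi by (simp add: G_def inner_simps norm_eq_1)
  have "G \<longlonglongrightarrow> f + (- (f \<bullet> \<phi>)) *\<^sub>R \<phi>"
    unfolding G_def by (intro tendsto_add tendsto_scaleR tendsto_minus tendsto_inner tendsto_const F)
  then have G_lim: "G \<longlonglongrightarrow> f" by (simp add: orth)
  show ?thesis
  proof (rule LIMSEQ_le)
    show "(\<lambda>n. norm (Q t (G n))) \<longlonglongrightarrow> norm (Q t f)"
      by (intro tendsto_norm Q_tendsto G_lim t)
    show "(\<lambda>n. exp (- \<delta> * t) * norm (G n)) \<longlonglongrightarrow> exp (- \<delta> * t) * norm f"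
      by (intro tendsto_mult tendsto_const tendsto_norm G_lim)
  qed (use decay[OF G_gen G_orth] in auto)
qed

end

section \<open>The Hilbert space of square-integrable functions\<close>

lemma L2_I: "f \<in> borel_measurable M \<Longrightarrow> integrable M (\<lambda>x. (f x)\<^sup>2) \<Longrightarrow> f \<in> L2 M"
  by (simp add: L2_def)

lemma L2_measurable: "f \<in> L2 M \<Longrightarrow> f \<in> borel_measurable M"
  by (simp add: L2_def)

lemma L2_square_integrable: "f \<in> L2 M \<Longrightarrow> integrable M (\<lambda>x. (f x)\<^sup>2)"
  by (simp add: L2_def)

lemma L2_mult_integrable:
  assumes f: "f \<in> L2 M" and g: "g \<in> L2 M"
  shows "integrable M (\<lambda>x. f x * g x)"
proof (rule Bochner_Integration.integrable_bound)
  show "integrable M (\<lambda>x. (f x)\<^sup>2 + (g x)\<^sup>2)"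
    using f g by (intro Bochner_Integration.integrable_add L2_square_integrable)
  show "(\<lambda>x. f x * g x) \<in> borel_measurable M"
    by (intro borel_measurable_times L2_measurable[OF f] L2_measurable[OF g])
  have "\<bar>a * b\<bar> \<le> a\<^sup>2 + b\<^sup>2" for a b :: real
  proof -
    have "2 * (\<bar>a\<bar> * \<bar>b\<bar>) \<le> a\<^sup>2 + b\<^sup>2"
      using zero_le_power2[of "\<bar>a\<bar> - \<bar>b\<bar>"] by (simp add: power2_diff)
    moreover have "0 \<le> \<bar>a\<bar> * \<bar>b\<bar>" by simp
    ultimately show ?thesis unfolding abs_mult by linarith
  qed
  then show "AE x in M. norm (f x * g x) \<le> norm ((f x)\<^sup>2 + (g x)\<^sup>2)"
    by (simp add: abs_of_nonneg)
qed

lemma L2_add: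
  assumes f: "f \<in> L2 M" and g: "g \<in> L2 M"
  shows "(\<lambda>x. f x + g x) \<in> L2 M"
proof (rule L2_I)
  have "integrable M (\<lambda>x. (f x)\<^sup>2 + (g x)\<^sup>2 + 2 * (f x * g x))"
    using f g by (intro Bochner_Integration.integrable_add integrable_mult_right
        L2_square_integrable L2_mult_integrable)
  then show "integrable M (\<lambda>x. (f x + g x)\<^sup>2)" by (simp add: power2_sum mult.assoc)
qed (intro borel_measurable_add L2_measurable[OF f] L2_measurable[OF g])

lemma L2_scale: "f \<in> L2 M \<Longrightarrow> (\<lambda>x. c * f x) \<in> L2 M"
  by (auto simp: L2_def power_mult_distrib)

lemma L2_zero: "(\<lambda>x. 0) \<in> L2 M"
  by (simp add: L2_def)

lemma L2_uminus: "f \<in> L2 M \<Longrightarrow> (\<lambda>x. - f x) \<in> L2 M"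
  using L2_scale[of f M "-1"] by simp

lemma L2_diff: "f \<in> L2 M \<Longrightarrow> g \<in> L2 M \<Longrightarrow> (\<lambda>x. f x - g x) \<in> L2 M"
  using L2_add[of f M "\<lambda>x. - g x"] L2_uminus by auto

lemma L2_abs: "f \<in> L2 M \<Longrightarrow> (\<lambda>x. \<bar>f x\<bar>) \<in> L2 M"
  by (auto simp: L2_def)

lemma L2_cong_AE:
  assumes f: "f \<in> L2 M" and g: "g \<in> borel_measurable M" and ae: "AE x in M. f x = g x"
  shows "g \<in> L2 M"
proof (rule L2_I[OF g])
  show "integrable M (\<lambda>x. (g x)\<^sup>2)"
  proof (rule integrable_cong_AE_imp[OF L2_square_integrable[OF f]])
    show "AE x in M. (f x)\<^sup>2 = (g x)\<^sup>2" using ae by eventually_elim simp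
  qed (use g in measurable)
qed

lemma L2_inner_cong_AE:
  assumes "f \<in> borel_measurable M" "f' \<in> borel_measurable M" "g \<in> borel_measurable M" "g' \<in> borel_measurable M"
    and "AE x in M. f x = f' x" "AE x in M. g x = g' x"
  shows "L2_inner M f g = L2_inner M f' g'"
  unfolding L2_inner_def using assms by (intro integral_cong_AE) auto

text \<open>The partial equivalence relation whose classes are the elements of the real Hilbert space
  \<open>L\<^sup>2(\<real>\<^sup>d)\<close>.\<close>

definition l2_rel :: "('a::euclidean_space \<Rightarrow> real) \<Rightarrow> ('a \<Rightarrow> real) \<Rightarrow> bool" where
  "l2_rel f g \<longleftrightarrow> f \<in> L2 lborel \<and> g \<in> L2 lborel \<and> (AE x in lborel. f x = g x)"

quotient_type (overloaded) 'a l2 = "'a::euclidean_space \<Rightarrow> real" / partial: l2_rel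
proof (rule part_equivpI)
  show "\<exists>f :: 'a \<Rightarrow> real. l2_rel f f"
    by (rule exI[of _ "\<lambda>x. 0"]) (simp add: l2_rel_def L2_zero)
  show "symp (l2_rel :: ('a \<Rightarrow> real) \<Rightarrow> _)"
    by (auto simp: symp_def l2_rel_def eq_commute)
  show "transp (l2_rel :: ('a \<Rightarrow> real) \<Rightarrow> _)"
  proof (rule transpI)
    fix f g h :: "'a \<Rightarrow> real" assume fg: "l2_rel f g" and gh: "l2_rel g h"
    have "AE x in lborel. f x = h x"
      using fg gh unfolding l2_rel_def by (auto elim: AE_E2 eventually_elim2)
    then show "l2_rel f h" using fg gh by (simp add: l2_rel_def)
  qed
qed

lemma l2_rel_self: "l2_rel f f \<longleftrightarrow> f \<in> L2 lborel"
  by (simp add: l2_rel_def)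

instantiation l2 :: (euclidean_space) real_inner
begin

lift_definition zero_l2 :: "'a l2" is "\<lambda>x. 0"
  by (simp add: l2_rel_def L2_zero)

lift_definition plus_l2 :: "'a l2 \<Rightarrow> 'a l2 \<Rightarrow> 'a l2" is "\<lambda>f g x. f x + g x"
  unfolding l2_rel_def by (auto intro: L2_add)

lift_definition minus_l2 :: "'a l2 \<Rightarrow> 'a l2 \<Rightarrow> 'a l2" is "\<lambda>f g x. f x - g x"
  unfolding l2_rel_def by (auto intro: L2_diff)

lift_definition uminus_l2 :: "'a l2 \<Rightarrow> 'a l2" is "\<lambda>f x. - f x"
  unfolding l2_rel_def by (auto intro: L2_uminus)

lift_definition scaleR_l2 :: "real \<Rightarrow> 'a l2 \<Rightarrow> 'a l2" is "\<lambda>c f x. c * f x"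
  unfolding l2_rel_def by (auto intro: L2_scale)

lift_definition inner_l2 :: "'a l2 \<Rightarrow> 'a l2 \<Rightarrow> real" is "L2_inner lborel"
  unfolding l2_rel_def by (intro L2_inner_cong_AE) (auto simp: L2_def)

definition norm_l2 :: "'a l2 \<Rightarrow> real" where "norm_l2 f = sqrt (f \<bullet> f)"

definition dist_l2 :: "'a l2 \<Rightarrow> 'a l2 \<Rightarrow> real" where "dist_l2 f g = norm (f - g)"

definition sgn_l2 :: "'a l2 \<Rightarrow> 'a l2" where "sgn_l2 f = scaleR (inverse (norm f)) f"

definition uniformity_l2 :: "('a l2 \<times> 'a l2) filter" where
  "uniformity_l2 = (INF e\<in>{0 <..}. principal {(x, y). dist x y < e})"

definition open_l2 :: "'a l2 set \<Rightarrow> bool" where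
  "open_l2 U \<longleftrightarrow> (\<forall>x\<in>U. eventually (\<lambda>(x', y). x' = x \<longrightarrow> y \<in> U) uniformity)"

instance
proof
  fix a b c :: "'a l2" and r s :: real
  show "a + b + c = a + (b + c)" by transfer (auto simp: l2_rel_def algebra_simps intro!: L2_add)
  show "a + b = b + a" by transfer (auto simp: l2_rel_def algebra_simps intro!: L2_add)
  show "0 + a = a" by transfer (auto simp: l2_rel_def)
  show "- a + a = 0" by transfer (auto simp: l2_rel_def L2_zero)
  show "a - b = a + - b" by transfer (auto simp: l2_rel_def intro!: L2_diff)
  show "r *\<^sub>R (a + b) = r *\<^sub>R a + r *\<^sub>R b"
    by transfer (auto simp: l2_rel_def algebra_simps intro!: L2_add L2_scale)
  show "(r + s) *\<^sub>R a = r *\<^sub>R a + s *\<^sub>R a"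
    by transfer (auto simp: l2_rel_def algebra_simps intro!: L2_add L2_scale)
  show "r *\<^sub>R s *\<^sub>R a = (r * s) *\<^sub>R a"
    by transfer (auto simp: l2_rel_def mult.assoc intro!: L2_scale)
  show "1 *\<^sub>R a = a" by transfer (auto simp: l2_rel_def)
  show "a \<bullet> b = b \<bullet> a" by transfer (simp add: L2_inner_def mult.commute)
  show "(a + b) \<bullet> c = a \<bullet> c + b \<bullet> c"
    by transfer (simp add: l2_rel_self L2_inner_def distrib_right L2_mult_integrable)
  show "(r *\<^sub>R a) \<bullet> b = r * (a \<bullet> b)"
    by transfer (simp add: L2_inner_def mult.assoc)
  show "0 \<le> a \<bullet> a" by transfer (simp add: L2_inner_def)
  show "a \<bullet> a = 0 \<longleftrightarrow> a = 0"
  proof transfer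
    fix f :: "'a \<Rightarrow> real" assume "l2_rel f f"
    then have "f \<in> L2 lborel" by (simp add: l2_rel_self)
    then show "L2_inner lborel f f = 0 \<longleftrightarrow> l2_rel f (\<lambda>x. 0)"
      using integral_nonneg_eq_0_iff_AE[of lborel "\<lambda>x. f x * f x"] L2_mult_integrable[of f lborel f]
      by (simp add: L2_inner_def l2_rel_def L2_zero)
  qed
qed (simp_all add: norm_l2_def dist_l2_def sgn_l2_def uniformity_l2_def open_l2_def)

end

lemma norm_l2_square: "f \<in> L2 lborel \<Longrightarrow> ennreal ((norm (abs_l2 f))\<^sup>2) = (\<integral>\<^sup>+x. ennreal ((f x)\<^sup>2) \<partial>lborel)"
  by (simp add: power2_norm_eq_inner inner_l2.abs_eq l2_rel_self L2_inner_def
      nn_integral_eq_integral L2_square_integrable flip: power2_eq_square)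

lemma l2_cases:
  obtains f where "f \<in> L2 lborel" "x = abs_l2 f"
  by (metis Quotient3_l2 Quotient3_abs_rep Quotient3_rep_reflp l2_rel_self)

lemma rep_l2_L2: "rep_l2 x \<in> L2 lborel"
  using Quotient3_rep_reflp[OF Quotient3_l2, of x] by (simp add: l2_rel_self)

lemma abs_rep_l2: "abs_l2 (rep_l2 x) = x"
  by (rule Quotient3_abs_rep[OF Quotient3_l2])

lemma inner_abs_l2: "f \<in> L2 lborel \<Longrightarrow> g \<in> L2 lborel \<Longrightarrow> abs_l2 f \<bullet> abs_l2 g = L2_inner lborel f g"
  by (simp add: inner_l2.abs_eq l2_rel_self)

lemma norm_abs_l2: "f \<in> L2 lborel \<Longrightarrow> norm (abs_l2 f) = L2_norm lborel f"
  by (simp add: norm_eq_sqrt_inner inner_abs_l2 L2_norm_def)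

lemma abs_l2_eq_iff: "f \<in> L2 lborel \<Longrightarrow> g \<in> L2 lborel \<Longrightarrow>
    abs_l2 f = abs_l2 g \<longleftrightarrow> (AE x in lborel. f x = g x)"
  using Quotient3_rel[OF Quotient3_l2, of f g] by (simp add: l2_rel_def)

lemma abs_l2_add: "f \<in> L2 lborel \<Longrightarrow> g \<in> L2 lborel \<Longrightarrow> abs_l2 f + abs_l2 g = abs_l2 (\<lambda>x. f x + g x)"
  by (simp add: plus_l2.abs_eq l2_rel_self)

lemma abs_l2_diff: "f \<in> L2 lborel \<Longrightarrow> g \<in> L2 lborel \<Longrightarrow> abs_l2 f - abs_l2 g = abs_l2 (\<lambda>x. f x - g x)"
  by (simp add: minus_l2.abs_eq l2_rel_self)

lemma abs_l2_scale: "f \<in> L2 lborel \<Longrightarrow> c *\<^sub>R abs_l2 f = abs_l2 (\<lambda>x. c * f x)"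
  by (simp add: scaleR_l2.abs_eq l2_rel_self)

text \<open>Riesz--Fischer. A subsequence with \<open>\<parallel>d\<^sub>k\<parallel>\<^sup>2 \<le> 16\<^sup>-\<^sup>k\<close> for its increments \<open>d\<^sub>k\<close> has
  \<open>\<integral> \<Sum>\<^sub>k 4\<^sup>k d\<^sub>k\<^sup>2 < \<infinity>\<close>. So \<open>d\<^sub>k = O(2\<^sup>-\<^sup>k)\<close> almost everywhere, the subsequence converges almost
  everywhere, and Fatou's lemma identifies its limit as the limit in \<open>L\<^sup>2\<close>.\<close>

instance l2 :: (euclidean_space) complete_space
proof
  fix X :: "nat \<Rightarrow> 'a l2" assume X: "Cauchy X"
  have "\<exists>f. f \<in> L2 lborel \<and> X n = abs_l2 f" for n by (metis l2_cases)
  then obtain f where f: "\<And>n. f n \<in> L2 lborel" and Xf: "\<And>n. X n = abs_l2 (f n)" by metis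
  note [measurable] = L2_measurable[OF f]
  have dist_X: "(\<integral>\<^sup>+x. ennreal ((f m x - f n x)\<^sup>2) \<partial>lborel) = ennreal ((dist (X m) (X n))\<^sup>2)" for m n
    by (simp add: Xf dist_norm abs_l2_diff f norm_l2_square L2_diff)
  have "\<exists>r. strict_mono r \<and> (\<forall>k::nat. \<forall>m\<ge>r k. \<forall>n\<ge>r k. dist (X m) (X n) < (1/4) ^ k)"
  proof -
    have "\<exists>N. \<forall>m\<ge>N. \<forall>n\<ge>N. dist (X m) (X n) < (1/4) ^ k" for k
      using metric_CauchyD[OF X, of "(1/4) ^ k"] by simp
    then obtain N where N: "\<And>k m n. m \<ge> N k \<Longrightarrow> n \<ge> N k \<Longrightarrow> dist (X m) (X n) < (1/4) ^ k"
      by metis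
    define r where "r k = k + (\<Sum>i\<le>k. N i)" for k
    have "strict_mono r" by (rule strict_monoI_Suc) (simp add: r_def)
    moreover have "N k \<le> r k" for k
      unfolding r_def by (rule trans_le_add2, rule member_le_sum) auto
    ultimately show ?thesis using N by (meson order_trans)
  qed
  then obtain r where r: "strict_mono r"
    and r_dist: "\<And>k m n. m \<ge> r k \<Longrightarrow> n \<ge> r k \<Longrightarrow> dist (X m) (X n) < (1/4) ^ k" by blast
  define d where "d k x = f (r (Suc k)) x - f (r k) x" for k x
  have [measurable]: "d k \<in> borel_measurable borel" for k
    using L2_measurable[OF f] by (simp add: d_def[abs_def])
  have d_le: "(\<integral>\<^sup>+x. ennreal (4 ^ k * (d k x)\<^sup>2) \<partial>lborel) \<le> ennreal ((1/4) ^ k)" for k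
  proof -
    have "(\<integral>\<^sup>+x. ennreal (4 ^ k * (d k x)\<^sup>2) \<partial>lborel) = ennreal (4 ^ k) * (\<integral>\<^sup>+x. ennreal ((d k x)\<^sup>2) \<partial>lborel)"
      by (subst nn_integral_cmult[symmetric]) (auto simp: ennreal_mult)
    also have "\<dots> = ennreal (4 ^ k * (dist (X (r (Suc k))) (X (r k)))\<^sup>2)"
      by (simp add: d_def dist_X ennreal_mult)
    also have "\<dots> \<le> ennreal (4 ^ k * ((1/4) ^ k)\<^sup>2)"
      using r_dist[of k "r (Suc k)" "r k"] strict_monoD[OF r, of k "Suc k"]
      by (intro ennreal_leI mult_left_mono power_mono) auto
    also have "4 ^ k * ((1/4) ^ k)\<^sup>2 = (1/4 :: real) ^ k"
      by (simp add: power2_eq_square power_divide)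
    finally show ?thesis .
  qed
  have "(\<integral>\<^sup>+x. (\<Sum>k. ennreal (4 ^ k * (d k x)\<^sup>2)) \<partial>lborel) = (\<Sum>k. \<integral>\<^sup>+x. ennreal (4 ^ k * (d k x)\<^sup>2) \<partial>lborel)"
    by (rule nn_integral_suminf) simp
  also have "\<dots> \<le> (\<Sum>k. ennreal ((1/4) ^ k))"
    by (intro suminf_le d_le) auto
  also have "\<dots> < \<infinity>"
    by (subst suminf_ennreal2) (simp_all add: summable_geometric)
  finally have fin: "(\<integral>\<^sup>+x. (\<Sum>k. ennreal (4 ^ k * (d k x)\<^sup>2)) \<partial>lborel) \<noteq> \<infinity>"
    by (rule less_imp_neq)
  have "AE x in lborel. (\<Sum>k. ennreal (4 ^ k * (d k x)\<^sup>2)) \<noteq> \<infinity>"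
  proof (rule nn_integral_PInf_AE[OF _ fin])
    have "(\<lambda>x. ennreal (4 ^ k * (d k x)\<^sup>2)) \<in> borel_measurable lborel" for k by simp
    then show "(\<lambda>x. \<Sum>k. ennreal (4 ^ k * (d k x)\<^sup>2)) \<in> borel_measurable lborel"
      by (rule borel_measurable_suminf_order)
  qed
  then have AE_conv: "AE x in lborel. convergent (\<lambda>k. f (r k) x)"
  proof eventually_elim
    fix x assume fin: "(\<Sum>k. ennreal (4 ^ k * (d k x)\<^sup>2)) \<noteq> \<infinity>"
    define e where "e k = ennreal (4 ^ k * (d k x)\<^sup>2)" for k
    define C where "C = enn2real (suminf e)"
    have C: "suminf e = ennreal C"
      using fin unfolding e_def[symmetric] C_def by (simp add: less_top)
    have "norm (d k x) \<le> sqrt C * (1/2) ^ k" for k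
    proof -
      have "sum e {k} \<le> suminf e" by (rule sum_le_suminf) (simp_all add: summableI)
      then have "ennreal (4 ^ k * (d k x)\<^sup>2) \<le> ennreal C" unfolding C e_def by simp
      then have "4 ^ k * (d k x)\<^sup>2 \<le> C" by (simp add: C_def ennreal_le_iff)
      then have "sqrt (4 ^ k * (d k x)\<^sup>2) \<le> sqrt C" by simp
      also have "sqrt (4 ^ k * (d k x)\<^sup>2) = 2 ^ k * \<bar>d k x\<bar>"
      proof -
        have "(4 :: real) ^ k = (2 ^ k)\<^sup>2" by (simp add: power2_eq_square flip: power_mult_distrib)
        then show ?thesis by (simp add: real_sqrt_mult)
      qed
      finally show ?thesis by (simp add: power_divide field_simps)
    qed
    moreover have "summable (\<lambda>k. sqrt C * (1/2 :: real) ^ k)"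
      by (rule summable_mult, rule summable_geometric) simp
    ultimately have "summable (\<lambda>k. d k x)"
      by (rule summable_comparison_test'[rotated])
    then have "convergent (\<lambda>n. \<Sum>k<n. d k x)" by (simp add: summable_iff_convergent)
    then have "convergent (\<lambda>n. f (r 0) x + (\<Sum>k<n. d k x))" by (rule convergent_add[OF convergent_const])
    moreover have "f (r 0) x + (\<Sum>k<n. d k x) = f (r n) x" for n
      unfolding d_def by (subst sum_lessThan_telescope) simp
    ultimately show "convergent (\<lambda>k. f (r k) x)" by simp
  qed
  define F where "F x = lim (\<lambda>k. f (r k) x)" for x
  have F_meas [measurable]: "F \<in> borel_measurable borel"
    using L2_measurable[OF f] unfolding F_def[abs_def] by (intro borel_measurable_lim_metric) simp
  have F_dist: "(\<integral>\<^sup>+x. ennreal ((f m x - F x)\<^sup>2) \<partial>lborel) \<le> ennreal (((1/4) ^ k)\<^sup>2)" if m: "m \<ge> r k" for m k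
  proof -
    have "(\<integral>\<^sup>+x. ennreal ((f m x - F x)\<^sup>2) \<partial>lborel)
        = (\<integral>\<^sup>+x. liminf (\<lambda>j. ennreal ((f m x - f (r j) x)\<^sup>2)) \<partial>lborel)"
    proof (rule nn_integral_cong_AE, use AE_conv in eventually_elim)
      fix x assume "convergent (\<lambda>k. f (r k) x)"
      then have "(\<lambda>j. f (r j) x) \<longlonglongrightarrow> F x" by (simp add: F_def convergent_LIMSEQ_iff)
      then have "(\<lambda>j. ennreal ((f m x - f (r j) x)\<^sup>2)) \<longlonglongrightarrow> ennreal ((f m x - F x)\<^sup>2)"
        by (rule tendsto_ennrealI[OF tendsto_power[OF tendsto_diff[OF tendsto_const]]])
      then show "ennreal ((f m x - F x)\<^sup>2) = liminf (\<lambda>j. ennreal ((f m x - f (r j) x)\<^sup>2))"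
        by (intro lim_imp_Liminf[symmetric]) simp_all
    qed
    also have "\<dots> \<le> liminf (\<lambda>j. \<integral>\<^sup>+x. ennreal ((f m x - f (r j) x)\<^sup>2) \<partial>lborel)"
      by (rule nn_integral_liminf) simp
    also have "\<dots> \<le> liminf (\<lambda>j. ennreal (((1/4) ^ k)\<^sup>2))"
    proof (rule Liminf_mono, rule eventually_sequentiallyI[of k])
      fix j assume "j \<ge> k"
      then have "r j \<ge> r k" using r by (simp add: strict_mono_less_eq)
      then show "(\<integral>\<^sup>+x. ennreal ((f m x - f (r j) x)\<^sup>2) \<partial>lborel) \<le> ennreal (((1/4) ^ k)\<^sup>2)"
        unfolding dist_X using r_dist[OF m, of "r j"] by (intro ennreal_leI power_mono) auto
    qed
    also have "\<dots> = ennreal (((1/4) ^ k)\<^sup>2)" by (simp add: Liminf_const)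
    finally show ?thesis .
  qed
  have "(\<lambda>x. f (r 0) x - F x) \<in> L2 lborel"
    using F_dist[of 0 "r 0"]
    by (intro L2_I integrableI_bounded) (auto simp: le_less_trans)
  from L2_diff[OF f[of "r 0"] this] have F: "F \<in> L2 lborel" by simp
  have "X \<longlonglongrightarrow> abs_l2 F"
  proof (rule metric_LIMSEQ_I)
    fix e :: real assume "e > 0"
    then obtain k where k: "(1/4) ^ k < e" using real_arch_pow_inv[of e "1/4"] by auto
    have "dist (X m) (abs_l2 F) < e" if m: "m \<ge> r k" for m
    proof -
      have "ennreal ((dist (X m) (abs_l2 F))\<^sup>2) \<le> ennreal (((1/4) ^ k)\<^sup>2)"
        using F_dist[OF m] by (simp add: Xf dist_norm abs_l2_diff f F norm_l2_square L2_diff)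
      then have "dist (X m) (abs_l2 F) \<le> (1/4) ^ k"
        by (simp add: power2_le_iff_abs_le)
      with k show ?thesis by simp
    qed
    then show "\<exists>no. \<forall>n\<ge>no. dist (X n) (abs_l2 F) < e" by blast
  qed
  then show "convergent X" by (auto simp: convergent_def)
qed

section \<open>Borel--Cantelli under decay of correlations and the integral test\<close>

lemma sum_geometric_distance_le:
  fixes q :: real
  assumes q: "0 \<le> q" "q < 1"
  shows "(\<Sum>n<N. q ^ (if m \<le> n then n - m else m - n)) \<le> 2 / (1 - q)"
proof -
  have fin: "(\<Sum>k<K. q ^ k) \<le> 1 / (1 - q)" for K
  proof -
    have "(\<Sum>k<K. q ^ k) \<le> (\<Sum>k. q ^ k)"
      using q by (intro sum_le_suminf summable_geometric) auto
    then show ?thesis using q by (simp add: suminf_geometric)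
  qed
  have "(\<Sum>n<N. q ^ (if m \<le> n then n - m else m - n))
      \<le> (\<Sum>n\<in>{..<Suc m} \<union> {m..<m + N}. q ^ (if m \<le> n then n - m else m - n))"
    using q by (intro sum_mono2) auto
  also have "\<dots> \<le> (\<Sum>n<Suc m. q ^ (if m \<le> n then n - m else m - n))
      + (\<Sum>n=m..<m + N. q ^ (if m \<le> n then n - m else m - n))"
    using q by (subst sum_Un) (auto intro!: sum_nonneg)
  also have "(\<Sum>n<Suc m. q ^ (if m \<le> n then n - m else m - n)) = (\<Sum>k<Suc m. q ^ k)"
    using sum.nat_diff_reindex[of "\<lambda>k. q ^ k" "Suc m"] by (auto intro!: sum.cong elim!: subst)
  also have "(\<Sum>n=m..<m + N. q ^ (if m \<le> n then n - m else m - n)) = (\<Sum>k<N. q ^ k)"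
    using sum.shift_bounds_nat_ivl[of "\<lambda>n. q ^ (if m \<le> n then n - m else m - n)" 0 m N]
    by (simp add: atLeast0LessThan add.commute)
  also have "(\<Sum>k<Suc m. q ^ k) + (\<Sum>k<N. q ^ k) \<le> 1 / (1 - q) + 1 / (1 - q)"
    by (intro add_mono fin)
  finally show ?thesis by simp
qed

lemma (in prob_space) integrable_indicator_event:
  "B \<in> events \<Longrightarrow> integrable M (indicator B :: 'a \<Rightarrow> real)"
  by (rule integrable_const_bound[where B=1]) (auto simp: indicator_def)

text \<open>The covariance of the indicators of \<open>A\<^sub>m\<close> and \<open>A\<^sub>n\<close> is at most \<open>q\<^bsup>\<bar>m-n\<bar>\<^esup> (p\<^sub>m + p\<^sub>n) / 2\<close> by the
  inequality of the means, and for fixed \<open>m\<close> the weights \<open>q\<^bsup>\<bar>m-n\<bar>\<^esup>\<close> have a bounded sum over \<open>n\<close>. So the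
  variance of the number of events grows at most like its mean.\<close>

lemma (in prob_space) variance_sum_indicator_le:
  fixes A :: "nat \<Rightarrow> 'a set" and q :: real
  assumes A [measurable]: "\<And>n. A n \<in> events" and q: "0 \<le> q" "q < 1"
    and corr: "\<And>m n. m < n \<Longrightarrow> prob (A m \<inter> A n) \<le> prob (A m) * prob (A n)
       + q ^ (n - m) * sqrt (prob (A m) * prob (A n))"
  shows "variance (\<lambda>x. \<Sum>n<N. indicator (A n) x) \<le> 2 / (1 - q) * (\<Sum>n<N. prob (A n))"
proof -
  define w where "w m n = q ^ (if m \<le> n then n - m else m - n)" for m n :: nat
  define p where "p n = prob (A n)" for n
  have w: "w m n = w n m" "w m n \<ge> 0" for m n using q by (auto simp: w_def)
  have w_sum: "(\<Sum>n<N. w m n) \<le> 2 / (1 - q)" for m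
    unfolding w_def by (rule sum_geometric_distance_le[OF q])
  have p: "p n \<ge> 0" for n by (simp add: p_def)
  have amgm: "sqrt (p m * p n) \<le> (p m + p n) / 2" for m n
    using arith_geo_mean_sqrt[OF p p] .
  have cov_less: "prob (A m \<inter> A n) - p m * p n \<le> w m n * ((p m + p n) / 2)" if "m < n" for m n
  proof -
    have "prob (A m \<inter> A n) - p m * p n \<le> w m n * sqrt (p m * p n)"
      using corr[OF that] that by (simp add: p_def w_def)
    also have "\<dots> \<le> w m n * ((p m + p n) / 2)" by (intro mult_left_mono amgm w)
    finally show ?thesis .
  qed
  have cov: "prob (A m \<inter> A n) - p m * p n \<le> w m n * ((p m + p n) / 2)" for m n
  proof (cases m n rule: linorder_cases)
    case greater
    then show ?thesis using cov_less[OF greater] by (simp add: Int_commute w(1) mult.commute add.commute)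
  qed (use cov_less p in \<open>auto simp: w_def p_def\<close>)
  have int: "expectation (indicator (A n)) = p n" for n by (simp add: p_def)
  have "variance (\<lambda>x. \<Sum>n<N. indicator (A n) x)
      = expectation (\<lambda>x. (\<Sum>n<N. indicator (A n) x)\<^sup>2) - (\<Sum>n<N. p n)\<^sup>2"
  proof (subst variance_eq)
    show "integrable M (\<lambda>x. (\<Sum>n<N. indicator (A n) x)\<^sup>2 :: real)"
      unfolding power2_eq_square sum_product indicator_inter_arith[symmetric]
    by (intro Bochner_Integration.integrable_sum integrable_indicator_event sets.Int A)
    have "integrable M (\<lambda>x. \<Sum>n<N. indicator (A n) x :: real)"
      by (intro Bochner_Integration.integrable_sum integrable_indicator_event A)
    then show "integrable M (\<lambda>x. \<Sum>n<N. indicator (A n) x :: real)" .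
    have "expectation (\<lambda>x. \<Sum>n<N. indicator (A n) x) = (\<Sum>n<N. p n)"
      by (subst Bochner_Integration.integral_sum) (simp_all add: p_def integrable_indicator_event)
    then show "expectation (\<lambda>x. (\<Sum>n<N. indicator (A n) x)\<^sup>2) - (expectation (\<lambda>x. \<Sum>n<N. indicator (A n) x))\<^sup>2
        = expectation (\<lambda>x. (\<Sum>n<N. indicator (A n) x)\<^sup>2) - (\<Sum>n<N. p n)\<^sup>2" by simp
  qed
  also have "expectation (\<lambda>x. (\<Sum>n<N. indicator (A n) x)\<^sup>2)
      = expectation (\<lambda>x. \<Sum>m<N. \<Sum>n<N. indicator (A m \<inter> A n) x :: real)"
    unfolding power2_eq_square sum_product indicator_inter_arith ..
  also have "\<dots> = (\<Sum>m<N. \<Sum>n<N. prob (A m \<inter> A n))"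
    by (simp add: Bochner_Integration.integral_sum integrable_indicator_event)
  also have "\<dots> - (\<Sum>n<N. p n)\<^sup>2 = (\<Sum>m<N. \<Sum>n<N. prob (A m \<inter> A n) - p m * p n)"
    by (simp add: power2_eq_square sum_product sum_subtractf)
  also have "\<dots> \<le> (\<Sum>m<N. \<Sum>n<N. w m n * ((p m + p n) / 2))"
    by (intro sum_mono cov)
  also have "\<dots> = (\<Sum>m<N. \<Sum>n<N. w m n * p m / 2) + (\<Sum>m<N. \<Sum>n<N. w m n * p n / 2)"
    by (simp add: sum.distrib[symmetric] field_simps)
  also have "(\<Sum>m<N. \<Sum>n<N. w m n * p n / 2) = (\<Sum>m<N. \<Sum>n<N. w m n * p m / 2)"
    by (subst sum.swap) (simp add: w(1))
  also have "(\<Sum>m<N. \<Sum>n<N. w m n * p m / 2) + (\<Sum>m<N. \<Sum>n<N. w m n * p m / 2)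
      = (\<Sum>m<N. p m * (\<Sum>n<N. w m n))"
    by (simp add: sum.distrib[symmetric] sum_distrib_left mult.commute)
  also have "\<dots> \<le> (\<Sum>m<N. p m * (2 / (1 - q)))"
    by (intro sum_mono mult_left_mono w_sum p)
  also have "\<dots> = 2 / (1 - q) * (\<Sum>n<N. p n)"
    by (simp only: sum_distrib_right mult.commute[of _ "sum p _"])
  finally show ?thesis by (simp add: p_def)
qed

text \<open>A second Borel--Cantelli lemma with exponentially decaying correlations in place of independence:
  the number \<open>S\<^sub>N\<close> of the first \<open>N\<close> events that occur has mean \<open>a\<^sub>N \<longlongrightarrow> \<infinity>\<close> and variance \<open>O(a\<^sub>N)\<close>, so
  Chebyshev's inequality bounds the probability that \<open>S\<^sub>N\<close> stays below a fixed \<open>K\<close> by \<open>O(1 / a\<^sub>N)\<close>.\<close>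

theorem (in prob_space) borel_cantelli_decaying_correlations:
  fixes A :: "nat \<Rightarrow> 'a set" and q :: real
  assumes A [measurable]: "\<And>n. A n \<in> events" and q: "0 \<le> q" "q < 1"
    and corr: "\<And>m n. m < n \<Longrightarrow> prob (A m \<inter> A n) \<le> prob (A m) * prob (A n)
       + q ^ (n - m) * sqrt (prob (A m) * prob (A n))"
    and div: "\<not> summable (\<lambda>n. prob (A n))"
  shows "AE x in M. \<exists>\<^sub>F n in sequentially. x \<in> A n"
proof -
  define S where "S N x = (\<Sum>n<N. indicator (A n) x :: real)" for N x
  define a where "a N = (\<Sum>n<N. prob (A n))" for N
  define C where "C = 2 / (1 - q)"
  have C: "C \<ge> 0" using q by (simp add: C_def)
  have [measurable]: "S N \<in> borel_measurable M" for N unfolding S_def by measurable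
  have ES: "expectation (S N) = a N" for N 
    unfolding S_def[abs_def] a_def
    by (subst Bochner_Integration.integral_sum) (simp_all add: integrable_indicator_event)
  have ES2: "integrable M (\<lambda>x. (S N x)\<^sup>2)" for N
    unfolding S_def power2_eq_square sum_product indicator_inter_arith[symmetric]
    by (intro Bochner_Integration.integrable_sum integrable_indicator_event sets.Int A)
  have a_unbounded: "\<exists>N. a N > B" for B
  proof (rule ccontr)
    assume "\<not> ?thesis"
    then have "summable (\<lambda>n. prob (A n))"
      by (intro summableI_nonneg_bounded[of _ B]) (auto simp: a_def not_less)
    with div show False by simp
  qed
  have null: "AE x in M. \<not> (\<forall>N. S N x \<le> real K)" for K :: nat
  proof -
    define E where "E = {x \<in> space M. \<forall>N. S N x \<le> real K}"
    have [measurable]: "E \<in> events" unfolding E_def by measurable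
    have le: "prob E \<le> \<epsilon>" if eps: "\<epsilon> > 0" for \<epsilon>
    proof -
      \<comment> \<open>The first bound makes \<open>K\<close> at most half the mean, the second makes the Chebyshev bound \<open>4 C / a\<^sub>N\<close> smaller than \<open>\<epsilon>\<close>.\<close>
      obtain N where N: "a N > max (2 * real K + 1) (4 * C / \<epsilon>)" using a_unbounded by blast
      have aN: "a N > 0" "real K < a N / 2" using N by auto
      have "prob E \<le> prob {x \<in> space M. a N / 2 \<le> \<bar>S N x - expectation (S N)\<bar>}"
      proof (rule finite_measure_mono)
        show "E \<subseteq> {x \<in> space M. a N / 2 \<le> \<bar>S N x - expectation (S N)\<bar>}"
        proof
          fix x assume x: "x \<in> E"
          then have "S N x \<le> real K" and sp: "x \<in> space M" unfolding E_def by blast+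
          then have "S N x < a N / 2" using aN(2) by linarith
          then show "x \<in> {x \<in> space M. a N / 2 \<le> \<bar>S N x - expectation (S N)\<bar>}"
            using sp unfolding mem_Collect_eq ES by (intro conjI) (assumption, linarith)
        qed
      qed measurable
      also have "\<dots> \<le> variance (S N) / (a N / 2)\<^sup>2"
        by (rule Chebyshev_inequality) (use aN ES2 in auto)
      also have "\<dots> \<le> C * a N / (a N / 2)\<^sup>2"
      proof (rule divide_right_mono)
        show "variance (S N) \<le> C * a N"
          using variance_sum_indicator_le[OF A q corr, of N] by (simp add: S_def[abs_def] a_def C_def)
      qed simp
      also have "\<dots> = 4 * C / a N" using aN by (simp add: power2_eq_square field_simps)
      also have "\<dots> \<le> \<epsilon>" using N aN eps by (simp add: field_simps)
      finally show ?thesis .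
    qed
    have "prob E \<le> 0" by (rule field_le_epsilon) (use le in simp)
    then have "prob E = 0" by (simp add: measure_le_0_iff)
    then have "AE x in M. x \<notin> E" by (subst (asm) prob_eq_0) auto
    then show ?thesis by (auto simp: E_def elim: AE_mp)
  qed
  have "AE x in M. \<forall>K::nat. \<not> (\<forall>N. S N x \<le> real K)"
    using null by (subst AE_all_countable) blast
  then show ?thesis
  proof eventually_elim
    fix x assume *: "\<forall>K::nat. \<not> (\<forall>N. S N x \<le> real K)"
    show "\<exists>\<^sub>F n in sequentially. x \<in> A n"
    proof (rule ccontr)
      assume "\<not> ?thesis"
      then obtain K where K: "\<And>n. n \<ge> K \<Longrightarrow> x \<notin> A n"
        by (auto simp: frequently_def eventually_sequentially)
      have "S N x \<le> real K" for N
      proof -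
        have "S N x \<le> (\<Sum>n<N. if n < K then 1 else 0)"
          unfolding S_def using K by (intro sum_mono) (auto simp: indicator_def not_less)
        also have "\<dots> = real (card ({..<N} \<inter> {..<K}))"
          by (simp add: sum.If_cases lessThan_def Collect_conj_eq)
        also have "\<dots> \<le> real (card {..<K})" by (intro of_nat_mono card_mono) auto
        finally show ?thesis by simp
      qed
      with * show False by blast
    qed
  qed
qed

text \<open>The integral test. On \<open>[n + 1, n + 2)\<close> the function lies between its values at the two end points.\<close>

lemma nn_integral_antimono_finite_iff:
  fixes G :: "real \<Rightarrow> ennreal"
  assumes anti: "\<And>r s. 1 \<le> r \<Longrightarrow> r \<le> s \<Longrightarrow> G s \<le> G r" and fin: "G 1 < \<infinity>"
  shows "(\<integral>\<^sup>+ r\<in>{1..}. G r \<partial>lborel) < \<infinity> \<longleftrightarrow> (\<Sum>n. G (real (Suc n))) < \<infinity>"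
proof -
  define I where "I n = {real (Suc n)..<real (Suc (Suc n))}" for n
  have disj: "disjoint_family I"
  proof -
    have "m = n" if "r \<in> I m" "r \<in> I n" for m n r
    proof -
      have "m < Suc n" "n < Suc m" using that unfolding I_def by auto
      then show ?thesis by simp
    qed
    then show ?thesis by (auto simp: disjoint_family_on_def)
  qed
  have step: "(\<integral>\<^sup>+ r. (\<Sum>n. c n * indicator (I n) r) \<partial>lborel) = (\<Sum>n. c n)" for c :: "nat \<Rightarrow> ennreal"
    by (subst nn_integral_suminf) (auto simp: I_def nn_integral_cmult_indicator)
  have at: "(\<Sum>n. c n * indicator (I n) r) = c (nat \<lfloor>r\<rfloor> - 1)" "real (Suc (nat \<lfloor>r\<rfloor> - 1)) \<le> r"
    "r \<le> real (Suc (Suc (nat \<lfloor>r\<rfloor> - 1)))" if "1 \<le> r" for r and c :: "nat \<Rightarrow> ennreal"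
  proof -
    have *: "real (Suc (nat \<lfloor>r\<rfloor> - 1)) = of_int \<lfloor>r\<rfloor>" using that by simp
    then show "real (Suc (nat \<lfloor>r\<rfloor> - 1)) \<le> r" "r \<le> real (Suc (Suc (nat \<lfloor>r\<rfloor> - 1)))"
      by linarith+
    have "r \<in> I (nat \<lfloor>r\<rfloor> - 1)" unfolding I_def using * by simp linarith
    then show "(\<Sum>n. c n * indicator (I n) r) = c (nat \<lfloor>r\<rfloor> - 1)"
      by (rule suminf_cmult_indicator[OF disj])
  qed
  have off: "(\<Sum>n. c n * indicator (I n) r) = 0" if "\<not> 1 \<le> r" for r and c :: "nat \<Rightarrow> ennreal"
    using that by (simp add: I_def indicator_def)
  have "(\<integral>\<^sup>+ r\<in>{1..}. G r \<partial>lborel) \<le> (\<integral>\<^sup>+ r. (\<Sum>n. G (real (Suc n)) * indicator (I n) r) \<partial>lborel)"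
  proof (rule nn_integral_mono)
    fix r show "G r * indicator {1..} r \<le> (\<Sum>n. G (real (Suc n)) * indicator (I n) r)"
    proof (cases "1 \<le> r")
      case True
      then show ?thesis using at(2)[OF True] by (subst at(1)[OF True]) (auto intro!: anti)
    qed simp
  qed
  then have upper: "(\<integral>\<^sup>+ r\<in>{1..}. G r \<partial>lborel) \<le> (\<Sum>n. G (real (Suc n)))" by (simp only: step)
  have "(\<integral>\<^sup>+ r. (\<Sum>n. G (real (Suc (Suc n))) * indicator (I n) r) \<partial>lborel) \<le> (\<integral>\<^sup>+ r\<in>{1..}. G r \<partial>lborel)"
  proof (rule nn_integral_mono)
    fix r show "(\<Sum>n. G (real (Suc (Suc n))) * indicator (I n) r) \<le> G r * indicator {1..} r"
    proof (cases "1 \<le> r")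
      case True
      then show ?thesis using at(3)[OF True] by (subst at(1)[OF True]) (auto intro!: anti)
    next
      case False
      then show ?thesis by (subst off[OF False]) simp
    qed
  qed
  then have lower: "(\<Sum>n. G (real (Suc (Suc n)))) \<le> (\<integral>\<^sup>+ r\<in>{1..}. G r \<partial>lborel)" by (simp only: step)
  have split: "(\<Sum>n. G (real (Suc n))) = G 1 + (\<Sum>n. G (real (Suc (Suc n))))"
    using suminf_offset[of "\<lambda>n. G (real (Suc n))" 1] by (simp add: summableI add.commute)
  show ?thesis
  proof
    assume "(\<integral>\<^sup>+ r\<in>{1..}. G r \<partial>lborel) < \<infinity>"
    then show "(\<Sum>n. G (real (Suc n))) < \<infinity>"
      unfolding split using fin le_less_trans[OF lower] by simp
  qed (use upper in \<open>simp add: le_less_trans\<close>)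
qed

text \<open>A zero-one dichotomy at every level \<open>c\<close> determines the upper limit: by monotonicity of the
  criterion it suffices to discard the exceptional null sets of the rational levels.\<close>

lemma AE_limsup_eq_threshold:
  fixes Y :: "nat \<Rightarrow> 'a \<Rightarrow> real" and \<tau> :: "nat \<Rightarrow> real"
  assumes \<tau>: "\<And>n. \<tau> n > 0"
    and upper: "\<And>c. c > 0 \<Longrightarrow> J c \<Longrightarrow> AE x in M. \<forall>\<^sub>F n in sequentially. Y n x < c * \<tau> n"
    and lower: "\<And>c. c > 0 \<Longrightarrow> \<not> J c \<Longrightarrow> AE x in M. \<exists>\<^sub>F n in sequentially. c * \<tau> n \<le> Y n x"
    and mono: "\<And>c c'. 0 < c \<Longrightarrow> c \<le> c' \<Longrightarrow> J c \<Longrightarrow> J c'"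
  shows "AE x in M. limsup (\<lambda>n. ennreal (Y n x / \<tau> n)) = Inf {ennreal c | c. 0 < c \<and> J c}"
proof -
  let ?I = "Inf {ennreal c | c. 0 < c \<and> J c}"
  have "AE x in M. \<forall>c\<in>\<rat> \<inter> {0<..}. (J c \<longrightarrow> (\<forall>\<^sub>F n in sequentially. Y n x < c * \<tau> n)) \<and>
     (\<not> J c \<longrightarrow> (\<exists>\<^sub>F n in sequentially. c * \<tau> n \<le> Y n x))"
  proof (rule AE_ball_countable'[rotated])
    show "countable (\<rat> \<inter> {0 :: real<..})" using countable_rat by blast
    fix c :: real assume "c \<in> \<rat> \<inter> {0<..}"
    then have c: "c > 0" by simp
    show "AE x in M. (J c \<longrightarrow> (\<forall>\<^sub>F n in sequentially. Y n x < c * \<tau> n)) \<and>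
     (\<not> J c \<longrightarrow> (\<exists>\<^sub>F n in sequentially. c * \<tau> n \<le> Y n x))"
      using upper[OF c] lower[OF c] by (cases "J c") auto
  qed
  then show ?thesis
  proof eventually_elim
    fix x assume *: "\<forall>c\<in>\<rat> \<inter> {0<..}. (J c \<longrightarrow> (\<forall>\<^sub>F n in sequentially. Y n x < c * \<tau> n)) \<and>
     (\<not> J c \<longrightarrow> (\<exists>\<^sub>F n in sequentially. c * \<tau> n \<le> Y n x))"
    have between: "\<exists>q\<in>\<rat> \<inter> {0<..}. y < ennreal q \<and> ennreal q < z" if "y < z" for y z :: ennreal
    proof -
      obtain w where w: "y < w" "w < z" using dense[OF \<open>y < z\<close>] by blast
      obtain a where a: "y = ennreal a" "a \<ge> 0" using w by (cases y) auto
      obtain b where b: "w = ennreal b" "b \<ge> 0" using w by (cases w) auto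
      have "a < b" using w a b by (simp add: ennreal_less_iff)
      then obtain q where q: "q \<in> \<rat>" "a < q" "q < b" using Rats_dense_in_real by blast
      have "y < ennreal q" using a q by (simp add: ennreal_less_iff)
      moreover have "ennreal q < z" using b q a w(2) by (intro less_trans[OF _ w(2)]) (simp add: ennreal_less_iff)
      ultimately show ?thesis using q a by (intro bexI[of _ q]) auto
    qed
    show "limsup (\<lambda>n. ennreal (Y n x / \<tau> n)) = ?I"
    proof (rule antisym)
      show "limsup (\<lambda>n. ennreal (Y n x / \<tau> n)) \<le> ?I"
      proof (rule ccontr)
        assume "\<not> ?thesis"
        then obtain q where q: "q \<in> \<rat>" "q > 0" "?I < ennreal q" "ennreal q < limsup (\<lambda>n. ennreal (Y n x / \<tau> n))"
          using between[of ?I] by (auto simp: not_le)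
        then obtain c where c: "0 < c" "J c" "ennreal c < ennreal q"
          unfolding Inf_less_iff by blast
        then have "c \<le> q" using q(2) by (simp add: ennreal_less_iff)
        with mono c have "J q" by blast
        then have "\<forall>\<^sub>F n in sequentially. Y n x < q * \<tau> n" using * q by blast
        then have "\<forall>\<^sub>F n in sequentially. ennreal (Y n x / \<tau> n) \<le> ennreal q"
          by eventually_elim (use \<tau> in \<open>auto intro!: ennreal_leI simp: divide_le_eq\<close>)
        then have "limsup (\<lambda>n. ennreal (Y n x / \<tau> n)) \<le> ennreal q" by (rule Limsup_bounded)
        with q(4) show False by simp
      qed
      show "?I \<le> limsup (\<lambda>n. ennreal (Y n x / \<tau> n))"
      proof (rule ccontr)
        assume "\<not> ?thesis"
        then obtain q where q: "q \<in> \<rat>" "q > 0" "limsup (\<lambda>n. ennreal (Y n x / \<tau> n)) < ennreal q" "ennreal q < ?I"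
          using between[of _ ?I] by (auto simp: not_le)
        have "\<not> J q"
        proof
          assume "J q"
          then have "?I \<le> ennreal q" using q(2) by (intro Inf_lower) blast
          with q(4) show False by simp
        qed
        then have freq: "\<exists>\<^sub>F n in sequentially. q * \<tau> n \<le> Y n x" using * q by blast
        have "\<forall>\<^sub>F n in sequentially. ennreal (Y n x / \<tau> n) < ennreal q"
          using q(3) by (rule Limsup_lessD)
        then have "\<forall>\<^sub>F n in sequentially. \<not> q * \<tau> n \<le> Y n x"
        proof eventually_elim
          fix n assume "ennreal (Y n x / \<tau> n) < ennreal q"
          then have "Y n x / \<tau> n < q" by (meson ennreal_leI not_less)
          then show "\<not> q * \<tau> n \<le> Y n x" using \<tau>[of n] by (simp add: divide_less_eq)
        qed
        with freq show False by (simp add: frequently_def)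
      qed
    qed
  qed
qed

section \<open>Spectral gap and correlations of the ground state transform\<close>

text \<open>Together with stationarity this inequality gives contractivity of the ground
  state-transformed semigroup.\<close>

lemma L2_mult_le_average:
  assumes f: "f \<in> L2 M" and g: "g \<in> L2 M"
  shows "(\<integral>x. f x * g x \<partial>M) \<le> ((\<integral>x. (f x)\<^sup>2 \<partial>M) + (\<integral>x. (g x)\<^sup>2 \<partial>M)) / 2"
proof -
  have "(\<integral>x. f x * g x \<partial>M) \<le> (\<integral>x. ((f x)\<^sup>2 + (g x)\<^sup>2) / 2 \<partial>M)"
  proof (rule integral_mono)
    show "integrable M (\<lambda>x. ((f x)\<^sup>2 + (g x)\<^sup>2) / 2)"
      using f g by (intro integrable_divide Bochner_Integration.integrable_add L2_square_integrable)
    show "f x * g x \<le> ((f x)\<^sup>2 + (g x)\<^sup>2) / 2" for x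
      using sum_squares_bound[of "f x" "g x"] by simp
  qed (rule L2_mult_integrable[OF f g])
  also have "\<dots> = ((\<integral>x. (f x)\<^sup>2 \<partial>M) + (\<integral>x. (g x)\<^sup>2 \<partial>M)) / 2"
    using f g by (simp add: L2_square_integrable)
  finally show ?thesis .
qed

text \<open>The domination property \<open>\<bar>T\<^sub>t f\<bar> \<le> T\<^sub>t \<bar>f\<bar>\<close> is the positivity of the Feynman--Kac
  semigroup; it makes the ground state energy a simple eigenvalue.\<close>

locale ground_state_transform =
  fixes T :: "real \<Rightarrow> ('a::euclidean_space \<Rightarrow> real) \<Rightarrow> 'a \<Rightarrow> real"
    and H :: "'a operator" and \<phi> :: "'a \<Rightarrow> real" and Px :: "'a \<Rightarrow> (real \<Rightarrow> 'a) measure"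
  assumes exp_semigroup: "is_exp_semigroup T H"
    and self_adjoint_H: "self_adjoint H"
    and abs_T_le: "\<bar>T t f x\<bar> \<le> T t (\<lambda>y. \<bar>f y\<bar>) x"
    and isolated: "isolated_eigenvalue H (Inf (Spec H))"
    and ground_state: "ground_state H \<phi>"
    and gst_process: "gst_process (gst_semigroup T (Inf (Spec H)) \<phi>) \<phi> Px"
begin

text \<open>The ground state energy.\<close>

definition E\<^sub>0 :: real where "E\<^sub>0 = Inf (Spec H)"

definition P :: "(real \<Rightarrow> 'a) measure" where "P = path_measure \<phi> Px"

lemma semigroup_T: "strongly_continuous_semigroup T"
  using exp_semigroup by (simp add: is_exp_semigroup_def)

lemma H_iff: "(f, h) \<in> H \<longleftrightarrow> f \<in> L2 lborel \<and> h \<in> L2 lborel \<and>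
    ((\<lambda>t. L2_norm lborel (\<lambda>x. (f x - T t f x) / t - h x)) \<longlongrightarrow> 0) (at_right 0)"
  using exp_semigroup by (auto simp: is_exp_semigroup_def)

lemma T_L2: "t \<ge> 0 \<Longrightarrow> f \<in> L2 lborel \<Longrightarrow> T t f \<in> L2 lborel"
  using semigroup_T by (simp add: strongly_continuous_semigroup_def)

lemma T_linear: "t \<ge> 0 \<Longrightarrow> f \<in> L2 lborel \<Longrightarrow> g \<in> L2 lborel \<Longrightarrow>
    AE x in lborel. T t (\<lambda>y. a * f y + b * g y) x = a * T t f x + b * T t g x"
  using semigroup_T by (simp add: strongly_continuous_semigroup_def)

lemma T_cong:
  assumes t: "t \<ge> 0" and f: "f \<in> L2 lborel" and g: "g \<in> L2 lborel" and eq: "AE x in lborel. f x = g x"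
  shows "AE x in lborel. T t f x = T t g x"
proof -
  let ?d = "\<lambda>y. 1 * f y + (-1) * g y"
  have d: "?d \<in> L2 lborel" using L2_diff[OF f g] by simp
  obtain C where C: "\<And>f. f \<in> L2 lborel \<Longrightarrow> L2_norm lborel (T t f) \<le> C * L2_norm lborel f"
    using semigroup_T t unfolding strongly_continuous_semigroup_def by metis
  have "abs_l2 ?d = 0"
    unfolding zero_l2_def using eq by (subst abs_l2_eq_iff[OF d L2_zero]) auto
  then have "L2_norm lborel ?d = 0" using norm_abs_l2[OF d] by simp
  then have "norm (abs_l2 (T t ?d)) \<le> 0"
    using C[OF d] norm_abs_l2[OF T_L2[OF t d]] by simp
  then have "abs_l2 (T t ?d) = abs_l2 (\<lambda>x. 0)" by (simp add: zero_l2_def)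
  then have "AE x in lborel. T t ?d x = 0"
    using abs_l2_eq_iff[OF T_L2[OF t d] L2_zero] by simp
  with T_linear[OF t f g, of 1 "-1"] show ?thesis by eventually_elim simp
qed

lemma phi_props: "(\<phi>, \<lambda>x. E\<^sub>0 * \<phi> x) \<in> H" "AE x in lborel. 0 < \<phi> x" "L2_norm lborel \<phi> = 1"
  using ground_state by (auto simp: ground_state_def eigenfunction_def E\<^sub>0_def Let_def)

lemma phi_L2: "\<phi> \<in> L2 lborel"
  using phi_props(1) by (simp add: H_iff)

lemma phi_measurable [measurable]: "\<phi> \<in> borel_measurable borel"
  using L2_measurable[OF phi_L2] by simp

lemma phi_square_integral: "(\<integral>x. (\<phi> x)\<^sup>2 \<partial>lborel) = 1"
  using phi_props(3) by (simp add: L2_norm_def L2_inner_def power2_eq_square)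

abbreviation W :: "'a measure" where "W \<equiv> weighted \<phi>"

lemma sets_W [simp, measurable_cong]: "sets W = sets borel"
  by (simp add: weighted_def)

lemma space_W [simp]: "space W = UNIV"
  by (simp add: weighted_def)

lemma prob_space_W: "prob_space W"
proof
  have "emeasure W (space W) = (\<integral>\<^sup>+x. ennreal ((\<phi> x)\<^sup>2) \<partial>lborel)"
    by (simp add: weighted_def emeasure_density)
  also have "\<dots> = 1"
    using nn_integral_eq_integral[OF L2_square_integrable[OF phi_L2]] phi_square_integral by simp
  finally show "emeasure W (space W) = 1" .
qed

lemma integral_W: "f \<in> borel_measurable borel \<Longrightarrow> (\<integral>x. f x \<partial>W) = (\<integral>x. (\<phi> x)\<^sup>2 * f x \<partial>lborel)"
  unfolding weighted_def by (subst integral_density) auto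

lemma L2_W_iff:
  assumes [measurable]: "f \<in> borel_measurable borel"
  shows "f \<in> L2 W \<longleftrightarrow> (\<lambda>x. \<phi> x * f x) \<in> L2 lborel"
proof -
  have "integrable W (\<lambda>x. (f x)\<^sup>2) \<longleftrightarrow> integrable lborel (\<lambda>x. (\<phi> x * f x)\<^sup>2)"
    unfolding weighted_def by (subst integrable_density) (auto simp: power_mult_distrib)
  then show ?thesis by (simp add: L2_def)
qed

lemma Px_measurable: "Px \<in> W \<rightarrow>\<^sub>M prob_algebra path_space"
proof -
  have "Px \<in> borel \<rightarrow>\<^sub>M prob_algebra path_space" using gst_process by (simp add: gst_process_def)
  moreover have "measurable W = measurable (borel :: 'a measure)"
    by (intro ext measurable_cong_sets) auto
  ultimately show ?thesis by simp
qed

lemma prob_space_P: "prob_space P"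
  unfolding P_def path_measure_def
  by (rule prob_space_bind'[where M=W]) (use Px_measurable prob_space_W in \<open>auto simp: space_prob_algebra\<close>)

sublocale P: prob_space P by (rule prob_space_P)

lemma sets_P [measurable_cong]: "sets P = sets path_space"
  unfolding P_def path_measure_def
  by (rule sets_bind'[where M=W]) (use Px_measurable prob_space_W in \<open>auto simp: space_prob_algebra\<close>)

lemma coordinate_measurable: "(\<lambda>\<omega>. \<omega> t) \<in> P \<rightarrow>\<^sub>M borel"
proof -
  have "(\<lambda>\<omega>. \<omega> t) \<in> path_space \<rightarrow>\<^sub>M (borel :: 'a measure)"
    unfolding path_space_def
    by (intro measurable_restrict_space1 measurable_component_singleton) simp
  then show ?thesis by (simp add: measurable_cong_sets[OF sets_P refl])
qed

text \<open>Multiplication by \<open>\<phi>\<close> maps \<open>L\<^sup>2(\<phi>\<^sup>2 dx)\<close> onto \<open>L\<^sup>2(dx)\<close> and turns the ground state-transformed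
  semigroup into \<open>e\<^bsup>E\<^sub>0 t\<^esup> T\<^sub>t\<close>, with which it is more convenient to work.\<close>

definition shifted_T :: "real \<Rightarrow> ('a \<Rightarrow> real) \<Rightarrow> 'a \<Rightarrow> real" where
  "shifted_T t f x = exp (E\<^sub>0 * t) * T t f x"

lemma shifted_T_L2: "t \<ge> 0 \<Longrightarrow> f \<in> L2 lborel \<Longrightarrow> shifted_T t f \<in> L2 lborel"
  unfolding shifted_T_def[abs_def] by (intro L2_scale T_L2)

lemma shifted_T_cong:
  assumes "t \<ge> 0" "f \<in> L2 lborel" "g \<in> L2 lborel" "AE x in lborel. f x = g x"
  shows "AE x in lborel. shifted_T t f x = shifted_T t g x"
  using T_cong[OF assms] by eventually_elim (simp add: shifted_T_def)

text \<open>The two-dimensional distributions of the process, transported from \<open>L\<^sup>2(\<phi>\<^sup>2 dx)\<close> to \<open>L\<^sup>2(dx)\<close>.\<close>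

lemma two_time_formula:
  assumes st: "s \<le> t" and f: "f \<in> L2 W" and g: "g \<in> L2 W"
  shows "(\<integral>\<omega>. f (\<omega> s) * g (\<omega> t) \<partial>P)
    = L2_inner lborel (\<lambda>x. \<phi> x * f x) (shifted_T (t - s) (\<lambda>x. \<phi> x * g x))"
proof -
  let ?S = "gst_semigroup T (Inf (Spec H)) \<phi>"
  define tt where "tt i = (if i = 0 then s else t)" for i :: nat
  define ff where "ff i = (if i = 0 then f else g)" for i :: nat
  have [measurable]: "f \<in> borel_measurable borel" "g \<in> borel_measurable borel"
    using L2_measurable[OF f] L2_measurable[OF g] by simp_all
  have phi_g: "(\<lambda>x. \<phi> x * g x) \<in> L2 lborel" using g by (simp add: L2_W_iff)
  have [measurable]: "shifted_T (t - s) (\<lambda>x. \<phi> x * g x) \<in> borel_measurable borel"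
    using L2_measurable[OF shifted_T_L2[OF _ phi_g]] st by simp
  have "\<forall>n\<ge>1. \<forall>(t :: nat \<Rightarrow> real) f.
        (\<forall>i<n. t i \<le> t (Suc i)) \<and>
        f 0 \<in> L2 W \<and> f n \<in> L2 W \<and>
        (\<forall>j. 0 < j \<and> j < n \<longrightarrow> f j \<in> borel_measurable borel \<and> bounded (range (f j))) \<longrightarrow>
        (\<integral>\<omega>. (\<Prod>j\<le>n. f j (\<omega> (t j))) \<partial>P) = L2_inner W (f 0) (semigroup_chain n ?S t f)"
    using gst_process unfolding gst_process_def P_def by blast
  from this[rule_format, of 1 tt ff]
  have "(\<integral>\<omega>. (\<Prod>j\<le>1. ff j (\<omega> (tt j))) \<partial>P) = L2_inner W (ff 0) (semigroup_chain 1 ?S tt ff)"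
    using st f g by (auto simp: tt_def ff_def)
  then have "(\<integral>\<omega>. f (\<omega> s) * g (\<omega> t) \<partial>P) = L2_inner W f (?S (t - s) g)"
    by (simp add: ff_def tt_def atMost_Suc mult.commute)
  also have "?S (t - s) g = (\<lambda>x. shifted_T (t - s) (\<lambda>x. \<phi> x * g x) x / \<phi> x)"
    by (simp add: gst_semigroup_def shifted_T_def E\<^sub>0_def fun_eq_iff)
  also have "L2_inner W f (\<lambda>x. shifted_T (t - s) (\<lambda>x. \<phi> x * g x) x / \<phi> x)
      = (\<integral>x. (\<phi> x)\<^sup>2 * (f x * (shifted_T (t - s) (\<lambda>x. \<phi> x * g x) x / \<phi> x)) \<partial>lborel)"
    unfolding L2_inner_def by (rule integral_W) measurable
  also have "\<dots> = L2_inner lborel (\<lambda>x. \<phi> x * f x) (shifted_T (t - s) (\<lambda>x. \<phi> x * g x))"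
    unfolding L2_inner_def
  proof (rule integral_cong_AE)
    show "AE x in lborel. (\<phi> x)\<^sup>2 * (f x * (shifted_T (t - s) (\<lambda>x. \<phi> x * g x) x / \<phi> x))
        = \<phi> x * f x * shifted_T (t - s) (\<lambda>x. \<phi> x * g x) x"
      using phi_props(2) by eventually_elim (simp add: power2_eq_square)
  qed measurable
  finally show ?thesis .
qed

lemma shifted_T_0: "f \<in> L2 lborel \<Longrightarrow> AE x in lborel. shifted_T 0 f x = f x"
  using semigroup_T by (simp add: strongly_continuous_semigroup_def shifted_T_def)

lemma indicator_L2_W:
  assumes B: "B \<in> sets borel"
  shows "indicator B \<in> L2 W"
proof -
  interpret W: prob_space W by (rule prob_space_W)
  have [measurable]: "indicator B \<in> borel_measurable W"
    by (rule borel_measurable_indicator) (simp add: B)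
  show ?thesis
    by (rule L2_I, measurable, rule W.integrable_const_bound[where B=1], simp add: indicator_def, measurable)
qed

lemma inner_indicator_phi:
  assumes B [measurable]: "B \<in> sets borel"
  shows "L2_inner lborel (\<lambda>x. \<phi> x * indicator B x) \<phi> = measure W B"
proof -
  have "L2_inner lborel (\<lambda>x. \<phi> x * indicator B x) \<phi> = (\<integral>x. indicator B x \<partial>W)"
    by (subst integral_W) (auto simp: L2_inner_def power2_eq_square mult_ac)
  then show ?thesis by simp
qed

text \<open>Stationarity, read off from the two-time formula at equal times with \<open>f = 1\<^sub>B\<close> and \<open>g = 1\<close>.\<close>

lemma marginal: "distr P borel (\<lambda>\<omega>. \<omega> t) = W"
proof (rule measure_eqI)
  show "sets (distr P borel (\<lambda>\<omega>. \<omega> t)) = sets W" by simp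
next
  fix B assume "B \<in> sets (distr P borel (\<lambda>\<omega>. \<omega> t))"
  then have B [measurable]: "B \<in> sets borel" by simp
  interpret W: prob_space W by (rule prob_space_W)
  have ind: "indicator B \<in> L2 W" "(\<lambda>x. 1) \<in> L2 W"
    using indicator_L2_W[OF B] indicator_L2_W[of UNIV] by simp_all
  have "measure P ((\<lambda>\<omega>. \<omega> t) -` B \<inter> space P) = (\<integral>\<omega>. indicator ((\<lambda>\<omega>. \<omega> t) -` B \<inter> space P) \<omega> \<partial>P)"
    by simp
  also have "\<dots> = (\<integral>\<omega>. indicator B (\<omega> t) * 1 \<partial>P)"
    by (intro Bochner_Integration.integral_cong) (auto simp: indicator_def)
  also have "\<dots> = L2_inner lborel (\<lambda>x. \<phi> x * indicator B x) (shifted_T 0 (\<lambda>x. \<phi> x * 1))"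
    using two_time_formula[OF order_refl ind] by simp
  also have "\<dots> = L2_inner lborel (\<lambda>x. \<phi> x * indicator B x) \<phi>"
    using shifted_T_0[OF phi_L2] L2_measurable[OF shifted_T_L2[OF order_refl phi_L2]]
    by (intro L2_inner_cong_AE) auto
  also have "\<dots> = measure W B" by (rule inner_indicator_phi[OF B])
  finally show "emeasure (distr P borel (\<lambda>\<omega>. \<omega> t)) B = emeasure W B"
    by (simp add: emeasure_distr[OF coordinate_measurable] P.emeasure_eq_measure W.emeasure_eq_measure)
qed

text \<open>For \<open>k = e\<^bsup>E\<^sub>0 t\<^esup> T\<^sub>t h\<close> the two-time formula gives
  \<open>\<parallel>k\<parallel>\<^sup>2 = E [(k / \<phi>)(X\<^sub>0) (h / \<phi>)(X\<^sub>t)] \<le> (\<parallel>k\<parallel>\<^sup>2 + \<parallel>h\<parallel>\<^sup>2) / 2\<close> by stationarity. This is the bound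
  \<open>\<parallel>T\<^sub>t\<parallel> \<le> e\<^bsup>- E\<^sub>0 t\<^esup>\<close>, obtained from the process instead of the functional calculus of \<open>H\<close>.\<close>

lemma shifted_T_contraction:
  assumes t: "t \<ge> 0" and h: "h \<in> L2 lborel"
  shows "L2_inner lborel (shifted_T t h) (shifted_T t h) \<le> L2_inner lborel h h"
proof -
  define k where "k = shifted_T t h"
  have k: "k \<in> L2 lborel" unfolding k_def by (rule shifted_T_L2[OF t h])
  \<comment> \<open>Division by \<open>\<phi>\<close> is an isometry from \<open>L\<^sup>2(dx)\<close> to \<open>L\<^sup>2(\<phi>\<^sup>2 dx)\<close>, and evaluation at time \<open>s\<close> is an isometry from there into \<open>L\<^sup>2(P)\<close>.\<close>
  have *: "(\<lambda>x. g x / \<phi> x) \<in> L2 W" "AE x in lborel. \<phi> x * (g x / \<phi> x) = g x"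
    "(\<lambda>x. \<phi> x * (g x / \<phi> x)) \<in> L2 lborel"
    "(\<lambda>\<omega>. g (\<omega> s) / \<phi> (\<omega> s)) \<in> L2 P"
    "(\<integral>\<omega>. (g (\<omega> s) / \<phi> (\<omega> s))\<^sup>2 \<partial>P) = L2_inner lborel g g"
    if g: "g \<in> L2 lborel" for g s
  proof -
    have [measurable]: "g \<in> borel_measurable borel" using L2_measurable[OF g] by simp
    show ae: "AE x in lborel. \<phi> x * (g x / \<phi> x) = g x"
      using phi_props(2) by eventually_elim simp
    then have "AE x in lborel. g x = \<phi> x * (g x / \<phi> x)" by eventually_elim simp
    then show L2: "(\<lambda>x. \<phi> x * (g x / \<phi> x)) \<in> L2 lborel"
      by (intro L2_cong_AE[OF g]) auto
    then show W: "(\<lambda>x. g x / \<phi> x) \<in> L2 W" by (subst L2_W_iff) auto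
    have "integrable (distr P borel (\<lambda>\<omega>. \<omega> s)) (\<lambda>x. (g x / \<phi> x)\<^sup>2)"
      using L2_square_integrable[OF W] by (simp only: marginal)
    then show "(\<lambda>\<omega>. g (\<omega> s) / \<phi> (\<omega> s)) \<in> L2 P"
      by (subst (asm) integrable_distr_eq)
        (auto intro!: L2_I coordinate_measurable measurable_compose[OF coordinate_measurable])
    have "(\<integral>\<omega>. (g (\<omega> s) / \<phi> (\<omega> s))\<^sup>2 \<partial>P) = (\<integral>x. (g x / \<phi> x)\<^sup>2 \<partial>distr P borel (\<lambda>\<omega>. \<omega> s))"
      by (subst integral_distr) (auto intro: coordinate_measurable)
    also have "\<dots> = (\<integral>x. (\<phi> x)\<^sup>2 * (g x / \<phi> x)\<^sup>2 \<partial>lborel)"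
      unfolding marginal by (rule integral_W) measurable
    also have "\<dots> = L2_inner lborel g g"
      unfolding L2_inner_def
    proof (rule integral_cong_AE)
      show "AE x in lborel. (\<phi> x)\<^sup>2 * (g x / \<phi> x)\<^sup>2 = g x * g x"
        using phi_props(2) by eventually_elim (simp add: power_divide power2_eq_square)
    qed measurable
    finally show "(\<integral>\<omega>. (g (\<omega> s) / \<phi> (\<omega> s))\<^sup>2 \<partial>P) = L2_inner lborel g g" .
  qed
  have "L2_inner lborel k k
      = L2_inner lborel (\<lambda>x. \<phi> x * (k x / \<phi> x)) (shifted_T t (\<lambda>x. \<phi> x * (h x / \<phi> x)))"
  proof (rule L2_inner_cong_AE)
    show "AE x in lborel. k x = \<phi> x * (k x / \<phi> x)" using *(2)[OF k] by eventually_elim simp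
    show "AE x in lborel. k x = shifted_T t (\<lambda>x. \<phi> x * (h x / \<phi> x)) x"
      using shifted_T_cong[OF t *(3)[OF h] h *(2)[OF h]] unfolding k_def by eventually_elim simp
  qed (intro L2_measurable k *(3)[OF k] *(3)[OF h] shifted_T_L2[OF t])+
  also have "\<dots> = (\<integral>\<omega>. (k (\<omega> 0) / \<phi> (\<omega> 0)) * (h (\<omega> t) / \<phi> (\<omega> t)) \<partial>P)"
    using two_time_formula[OF t *(1)[OF k] *(1)[OF h]] by simp
  also have "\<dots> \<le> (L2_inner lborel k k + L2_inner lborel h h) / 2"
    using L2_mult_le_average[OF *(4)[OF k] *(4)[OF h], of 0 t] *(5)[OF k] *(5)[OF h] by simp
  finally show ?thesis by (simp add: k_def)
qed

definition Q :: "real \<Rightarrow> 'a l2 \<Rightarrow> 'a l2" where "Q t x = abs_l2 (shifted_T t (rep_l2 x))"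

lemma Q_abs:
  assumes t: "t \<ge> 0" and f: "f \<in> L2 lborel"
  shows "Q t (abs_l2 f) = abs_l2 (shifted_T t f)"
proof -
  have "AE x in lborel. rep_l2 (abs_l2 f) x = f x"
    using abs_l2_eq_iff[OF rep_l2_L2 f] abs_rep_l2 by blast
  then show ?thesis
    using shifted_T_cong[OF t rep_l2_L2 f] t f unfolding Q_def
    by (simp add: abs_l2_eq_iff shifted_T_L2 rep_l2_L2)
qed

lemma abs_shifted_T: "t \<ge> 0 \<Longrightarrow> f \<in> L2 lborel \<Longrightarrow> abs_l2 (shifted_T t f) = exp (E\<^sub>0 * t) *\<^sub>R abs_l2 (T t f)"
  by (simp add: abs_l2_scale T_L2 shifted_T_def[abs_def])

lemma abs_T_tendsto:
  assumes f: "f \<in> L2 lborel"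
  shows "((\<lambda>t. abs_l2 (T t f)) \<longlongrightarrow> abs_l2 f) (at_right 0)"
proof -
  have "((\<lambda>t. L2_norm lborel (\<lambda>x. T t f x - f x)) \<longlongrightarrow> 0) (at_right 0)"
    using semigroup_T f by (simp add: strongly_continuous_semigroup_def)
  moreover have "\<forall>\<^sub>F t in at_right 0. L2_norm lborel (\<lambda>x. T t f x - f x) = norm (abs_l2 (T t f) - abs_l2 f)"
    by (rule eventually_at_rightI[of 0 1]) (auto simp: abs_l2_diff T_L2 f norm_abs_l2 L2_diff)
  ultimately have "((\<lambda>t. norm (abs_l2 (T t f) - abs_l2 f)) \<longlongrightarrow> 0) (at_right 0)"
    by (rule Lim_transform_eventually)
  then have "((\<lambda>t. abs_l2 (T t f) - abs_l2 f) \<longlongrightarrow> 0) (at_right 0)"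
    by (rule tendsto_norm_zero_cancel)
  then show ?thesis by (rule LIM_zero_cancel)
qed

lemma contraction_semigroup_Q: "contraction_semigroup Q"
proof (rule contraction_semigroup.intro)
  fix t :: real assume t: "t \<ge> 0"
  show "linear (Q t)"
  proof (rule linearI)
    fix x y :: "'a l2"
    obtain f where f: "f \<in> L2 lborel" "x = abs_l2 f" by (rule l2_cases)
    obtain g where g: "g \<in> L2 lborel" "y = abs_l2 g" by (rule l2_cases)
    have "AE x in lborel. shifted_T t (\<lambda>x. f x + g x) x = shifted_T t f x + shifted_T t g x"
      using T_linear[OF t f(1) g(1), of 1 1] by eventually_elim (simp add: shifted_T_def algebra_simps)
    then show "Q t (x + y) = Q t x + Q t y"
      using t f g by (simp add: Q_abs abs_l2_add L2_add shifted_T_L2 abs_l2_eq_iff)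
  next
    fix c :: real and x :: "'a l2"
    obtain f where f: "f \<in> L2 lborel" "x = abs_l2 f" by (rule l2_cases)
    have "AE x in lborel. shifted_T t (\<lambda>x. c * f x) x = c * shifted_T t f x"
      using T_linear[OF t f(1) f(1), of c 0] by eventually_elim (simp add: shifted_T_def)
    then show "Q t (c *\<^sub>R x) = c *\<^sub>R Q t x"
      using t f by (simp add: Q_abs abs_l2_scale L2_scale shifted_T_L2 abs_l2_eq_iff)
  qed
next
  fix t :: real and x :: "'a l2" assume t: "t \<ge> 0"
  obtain f where f: "f \<in> L2 lborel" "x = abs_l2 f" by (rule l2_cases)
  show "norm (Q t x) \<le> norm x"
    using shifted_T_contraction[OF t f(1)] f t
    by (simp add: Q_abs norm_eq_sqrt_inner inner_abs_l2 shifted_T_L2)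
next
  fix x :: "'a l2"
  obtain f where f: "f \<in> L2 lborel" "x = abs_l2 f" by (rule l2_cases)
  show "Q 0 x = x" using shifted_T_0[OF f(1)] f by (simp add: Q_abs abs_l2_eq_iff shifted_T_L2)
next
  fix s t :: real and x :: "'a l2" assume s: "s \<ge> 0" and t: "t \<ge> 0"
  obtain f where f: "f \<in> L2 lborel" "x = abs_l2 f" by (rule l2_cases)
  have 1: "AE x in lborel. T (s + t) f x = T s (T t f) x"
    using semigroup_T s t f by (simp add: strongly_continuous_semigroup_def)
  have 2: "AE x in lborel. T s (shifted_T t f) x = exp (E\<^sub>0 * t) * T s (T t f) x"
    using T_linear[OF s T_L2[OF t f(1)] T_L2[OF t f(1)], of "exp (E\<^sub>0 * t)" 0]
    by (simp add: shifted_T_def[abs_def])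
  from 1 2 have "AE x in lborel. shifted_T (s + t) f x = shifted_T s (shifted_T t f) x"
    by eventually_elim (simp add: shifted_T_def[of s] shifted_T_def[of "s + t"] distrib_left exp_add)
  then show "Q (s + t) x = Q s (Q t x)"
    using s t f by (simp add: Q_abs abs_l2_eq_iff shifted_T_L2)
next
  fix x :: "'a l2"
  obtain f where f: "f \<in> L2 lborel" "x = abs_l2 f" by (rule l2_cases)
  have "((\<lambda>t. exp (E\<^sub>0 * t)) \<longlongrightarrow> exp (E\<^sub>0 * 0)) (at_right 0)"
    by (intro tendsto_intros)
  from tendsto_scaleR[OF this abs_T_tendsto[OF f(1)]]
  have "((\<lambda>t. exp (E\<^sub>0 * t) *\<^sub>R abs_l2 (T t f)) \<longlongrightarrow> x) (at_right 0)" by (simp add: f(2))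
  moreover have "\<forall>\<^sub>F t in at_right 0. exp (E\<^sub>0 * t) *\<^sub>R abs_l2 (T t f) = Q t x"
    by (rule eventually_at_rightI[of 0 1]) (auto simp: Q_abs f abs_shifted_T)
  ultimately show "((\<lambda>t. Q t x) \<longlongrightarrow> x) (at_right 0)"
    by (rule Lim_transform_eventually)
qed

sublocale contraction_semigroup Q by (rule contraction_semigroup_Q)

text \<open>The rescaling lemma with \<open>a = E\<^sub>0\<close> gives one inclusion of graphs, with \<open>a = - E\<^sub>0\<close> the other.\<close>

lemma H_iff_gen:
  assumes f: "f \<in> L2 lborel" and h: "h \<in> L2 lborel"
  shows "(f, h) \<in> H \<longleftrightarrow> (abs_l2 f, abs_l2 h - E\<^sub>0 *\<^sub>R abs_l2 f) \<in> gen"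
proof -
  let ?U = "\<lambda>t. abs_l2 (T t f)"
  have "\<forall>\<^sub>F t in at_right 0. L2_norm lborel (\<lambda>x. (f x - T t f x) / t - h x)
      = norm ((abs_l2 f - ?U t) /\<^sub>R t - abs_l2 h)"
  proof (rule eventually_at_rightI[of 0 1])
    fix t :: real assume t: "t \<in> {0<..<1}"
    have L2: "(\<lambda>x. f x - T t f x) \<in> L2 lborel" using t f by (intro L2_diff T_L2) auto
    have "(abs_l2 f - ?U t) /\<^sub>R t - abs_l2 h = abs_l2 (\<lambda>x. inverse t * (f x - T t f x) - h x)"
      using t f h L2 by (simp add: abs_l2_diff abs_l2_scale T_L2 L2_scale)
    then show "L2_norm lborel (\<lambda>x. (f x - T t f x) / t - h x) = norm ((abs_l2 f - ?U t) /\<^sub>R t - abs_l2 h)"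
      using norm_abs_l2[OF L2_diff[OF L2_scale[OF L2, of "inverse t"] h]]
      by (simp add: divide_inverse mult.commute)
  qed simp
  then have "(f, h) \<in> H \<longleftrightarrow> ((\<lambda>t. norm ((abs_l2 f - ?U t) /\<^sub>R t - abs_l2 h)) \<longlongrightarrow> 0) (at_right 0)"
    unfolding H_iff using f h by (simp add: tendsto_cong)
  also have "\<dots> \<longleftrightarrow> ((\<lambda>t. (abs_l2 f - ?U t) /\<^sub>R t) \<longlongrightarrow> abs_l2 h) (at_right 0)"
    by (simp add: tendsto_norm_zero_iff LIM_zero_iff)
  also have "\<dots> \<longleftrightarrow> (abs_l2 f, abs_l2 h - E\<^sub>0 *\<^sub>R abs_l2 f) \<in> gen" (is "?L \<longleftrightarrow> ?R")
  proof
    assume ?L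
    from tendsto_generator_rescale[OF this abs_T_tendsto[OF f], of E\<^sub>0]
    show ?R unfolding gen_def mem_Collect_eq prod.case
    proof (rule Lim_transform_eventually)
      show "\<forall>\<^sub>F t in at_right 0. (abs_l2 f - exp (E\<^sub>0 * t) *\<^sub>R abs_l2 (T t f)) /\<^sub>R t = (abs_l2 f - Q t (abs_l2 f)) /\<^sub>R t"
        by (rule eventually_at_rightI[of 0 1]) (auto simp: Q_abs f abs_shifted_T)
    qed
  next
    assume ?R
    then have "((\<lambda>t. (abs_l2 f - Q t (abs_l2 f)) /\<^sub>R t) \<longlongrightarrow> abs_l2 h - E\<^sub>0 *\<^sub>R abs_l2 f) (at_right 0)"
      by (simp add: gen_def)
    from tendsto_generator_rescale[OF this cont0, of "- E\<^sub>0"]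
    have "((\<lambda>t. (abs_l2 f - exp (- E\<^sub>0 * t) *\<^sub>R Q t (abs_l2 f)) /\<^sub>R t) \<longlongrightarrow> abs_l2 h) (at_right 0)"
      by simp
    then show ?L
    proof (rule Lim_transform_eventually)
      show "\<forall>\<^sub>F t in at_right 0. (abs_l2 f - exp (- E\<^sub>0 * t) *\<^sub>R Q t (abs_l2 f)) /\<^sub>R t = (abs_l2 f - abs_l2 (T t f)) /\<^sub>R t"
        by (rule eventually_at_rightI[of 0 1]) (auto simp: Q_abs f abs_shifted_T exp_minus)
    qed
  qed
  finally show ?thesis .
qed

lemma gen_cases:
  assumes "(x, y) \<in> gen"
  obtains f h where "f \<in> L2 lborel" "h \<in> L2 lborel" "(f, h) \<in> H" "x = abs_l2 f" "y = abs_l2 h - E\<^sub>0 *\<^sub>R abs_l2 f"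
proof -
  obtain f where f: "f \<in> L2 lborel" "x = abs_l2 f" by (rule l2_cases)
  obtain h where h: "h \<in> L2 lborel" "y + E\<^sub>0 *\<^sub>R x = abs_l2 h" by (rule l2_cases)
  have y: "y = abs_l2 h - E\<^sub>0 *\<^sub>R abs_l2 f" using f h by (metis add_diff_cancel_right')
  then have "(f, h) \<in> H" using assms f h by (simp add: H_iff_gen)
  with f h y show thesis by (intro that)
qed

lemma H_L2: "(f, h) \<in> H \<Longrightarrow> f \<in> L2 lborel" "(f, h) \<in> H \<Longrightarrow> h \<in> L2 lborel"
  by (simp_all add: H_iff)

sublocale symmetric_contraction_semigroup Q
proof
  fix x y x' y' assume "(x, y) \<in> gen" "(x', y') \<in> gen"
  obtain f h where f: "f \<in> L2 lborel" "h \<in> L2 lborel" "(f, h) \<in> H" "x = abs_l2 f" "y = abs_l2 h - E\<^sub>0 *\<^sub>R abs_l2 f"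
    by (rule gen_cases[OF \<open>(x, y) \<in> gen\<close>])
  obtain g k where g: "g \<in> L2 lborel" "k \<in> L2 lborel" "(g, k) \<in> H" "x' = abs_l2 g" "y' = abs_l2 k - E\<^sub>0 *\<^sub>R abs_l2 g"
    by (rule gen_cases[OF \<open>(x', y') \<in> gen\<close>])
  have "L2_inner lborel f k = L2_inner lborel h g"
    using self_adjoint_H f(3) g(3) unfolding self_adjoint_def by blast
  then show "x \<bullet> y' = y \<bullet> x'"
    using f g by (simp add: inner_diff_left inner_diff_right inner_abs_l2)
next
  fix e :: real and x :: "'a l2" assume e: "e > 0"
  obtain f where f: "f \<in> L2 lborel" "x = abs_l2 f" by (rule l2_cases)
  obtain g k where g: "(g, k) \<in> H" "L2_norm lborel (\<lambda>x. g x - f x) < e"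
    using self_adjoint_H f(1) e unfolding self_adjoint_def by blast
  then have "(abs_l2 g, abs_l2 k - E\<^sub>0 *\<^sub>R abs_l2 g) \<in> gen" using H_iff_gen H_L2[OF g(1)] by blast
  moreover have "norm (abs_l2 g - x) < e"
    using g(2) f H_L2[OF g(1)] by (simp add: abs_l2_diff norm_abs_l2 L2_diff)
  ultimately show "\<exists>g k. (g, k) \<in> gen \<and> norm (g - x) < e" by blast
qed

lemma resolvent_at_gap: 
  assumes mu: "E\<^sub>0 + \<mu> \<in> resolvent_set H"
  shows "resolvent_at \<mu>"
  unfolding resolvent_at_def
proof (intro conjI allI)
  fix y :: "'a l2"
  obtain g where g: "g \<in> L2 lborel" "y = abs_l2 g" by (rule l2_cases)
  obtain f h where fh: "(f, h) \<in> H" "AE x in lborel. h x - (E\<^sub>0 + \<mu>) * f x = g x"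
    using mu g unfolding resolvent_set_def by blast
  note L2 = H_L2[OF fh(1)]
  have "abs_l2 h - (E\<^sub>0 + \<mu>) *\<^sub>R abs_l2 f = abs_l2 g"
    using fh(2) L2 g by (simp add: abs_l2_diff abs_l2_scale L2_scale L2_diff abs_l2_eq_iff)
  then have "(abs_l2 h - E\<^sub>0 *\<^sub>R abs_l2 f) - \<mu> *\<^sub>R abs_l2 f = y"
    by (simp add: g scaleR_add_left diff_diff_eq)
  then show "\<exists>f h. (f, h) \<in> gen \<and> h - \<mu> *\<^sub>R f = y"
    using H_iff_gen[OF L2] fh(1) by blast
next
  obtain C where C: "\<And>f h. (f, h) \<in> H \<Longrightarrow>
      L2_norm lborel f \<le> C * L2_norm lborel (\<lambda>x. h x - (E\<^sub>0 + \<mu>) * f x)"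
    using mu unfolding resolvent_set_def by blast
  show "\<exists>C. \<forall>(f, h)\<in>gen. norm f \<le> C * norm (h - \<mu> *\<^sub>R f)"
  proof (intro exI[of _ C] ballI, clarify)
    fix x y assume "(x, y) \<in> gen"
    then obtain f h where f: "f \<in> L2 lborel" "h \<in> L2 lborel" "(f, h) \<in> H" "x = abs_l2 f"
        "y = abs_l2 h - E\<^sub>0 *\<^sub>R abs_l2 f"
      by (rule gen_cases)
    have "y - \<mu> *\<^sub>R x = abs_l2 h - (E\<^sub>0 + \<mu>) *\<^sub>R abs_l2 f"
      by (simp add: f scaleR_add_left diff_diff_eq)
    also have "\<dots> = abs_l2 (\<lambda>x. h x - (E\<^sub>0 + \<mu>) * f x)"
      using f by (simp add: abs_l2_diff abs_l2_scale L2_scale)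
    finally show "norm x \<le> C * norm (y - \<mu> *\<^sub>R x)"
      using C[OF f(3)] f by (simp add: norm_abs_l2 L2_diff L2_scale)
  qed
qed

text \<open>An open set that isolates \<open>E\<^sub>0\<close> from the rest of the spectrum of \<open>H\<close> contains an interval to the
  right of \<open>E\<^sub>0\<close>.\<close>

lemma spectral_gap:
  obtains \<delta> where "\<delta> > 0" "\<And>\<mu>. 0 < \<mu> \<Longrightarrow> \<mu> < \<delta> \<Longrightarrow> resolvent_at \<mu>"
proof -
  have "E\<^sub>0 isolated_in Spec H"
    using isolated by (simp add: isolated_eigenvalue_def E\<^sub>0_def)
  then obtain U where U: "open U" "U \<inter> Spec H = {E\<^sub>0}" by (auto simp: isolated_in_def)
  then obtain \<delta> where d: "\<delta> > 0" "ball E\<^sub>0 \<delta> \<subseteq> U" by (metis Int_iff insertI1 open_contains_ball)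
  have "resolvent_at \<mu>" if "0 < \<mu>" "\<mu> < \<delta>" for \<mu>
  proof (rule resolvent_at_gap)
    have "E\<^sub>0 + \<mu> \<in> ball E\<^sub>0 \<delta>" using that by (simp add: dist_real_def)
    then have "E\<^sub>0 + \<mu> \<in> U" using d(2) by blast
    then have "E\<^sub>0 + \<mu> \<notin> Spec H" using U(2) that by (metis IntI add_cancel_left_right less_irrefl singletonD)
    then show "E\<^sub>0 + \<mu> \<in> resolvent_set H" by (simp add: Spec_def)
  qed
  with d(1) show thesis by (rule that)
qed

lemma Q_phi: "t \<ge> 0 \<Longrightarrow> Q t (abs_l2 \<phi>) = abs_l2 \<phi>"
proof (rule gen_0_imp_fixed)
  show "(abs_l2 \<phi>, 0) \<in> gen"
    using phi_props(1) H_iff_gen[OF phi_L2 L2_scale[OF phi_L2, of E\<^sub>0]]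
    by (simp add: abs_l2_scale phi_L2)
qed

lemma norm_phi: "norm (abs_l2 \<phi>) = 1"
  by (simp add: norm_abs_l2 phi_L2 phi_props)

text \<open>If \<open>u \<ge> 0\<close> is a fixed vector, then the normalisation of \<open>\<phi> + u\<close> is a strictly positive normalised
  ground state, hence equal to \<open>\<phi>\<close>.\<close>

lemma nonneg_fixed_vector:
  assumes u: "u \<in> L2 lborel" "AE x in lborel. 0 \<le> u x"
    and fixed: "\<And>t. t \<ge> 0 \<Longrightarrow> Q t (abs_l2 u) = abs_l2 u"
  shows "\<exists>c. abs_l2 u = c *\<^sub>R abs_l2 \<phi>"
proof -
  define N where "N = norm (abs_l2 \<phi> + abs_l2 u)"
  have "abs_l2 \<phi> \<bullet> abs_l2 u = (\<integral>x. \<phi> x * u x \<partial>lborel)"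
    by (simp add: inner_abs_l2 phi_L2 u L2_inner_def)
  also have "\<dots> \<ge> 0"
  proof (rule integral_nonneg_AE)
    show "AE x in lborel. 0 \<le> \<phi> x * u x"
      using phi_props(2) u(2) by eventually_elim simp
  qed
  finally have "N\<^sup>2 \<ge> 1"
    using norm_phi unfolding N_def power2_norm_eq_inner
    by (simp add: inner_add_left inner_add_right inner_commute norm_eq_1)
  then have N: "N > 0" unfolding N_def by (metis norm_le_zero_iff not_le not_one_le_zero norm_zero zero_power2)
  define \<psi> where "\<psi> x = (1 / N) * (\<phi> x + u x)" for x
  have psi_L2: "\<psi> \<in> L2 lborel" unfolding \<psi>_def[abs_def] by (intro L2_scale L2_add phi_L2 u)
  have psi: "abs_l2 \<psi> = (1 / N) *\<^sub>R (abs_l2 \<phi> + abs_l2 u)"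
    unfolding \<psi>_def[abs_def] by (simp add: abs_l2_add abs_l2_scale phi_L2 u L2_add)
  have norm_psi: "norm (abs_l2 \<psi>) = 1" using N by (simp add: psi N_def)
  have "Q t (abs_l2 \<psi>) = abs_l2 \<psi>" if "t \<ge> 0" for t
    using that by (simp add: psi Q_scale Q_linear_comb Q_phi fixed)
  then have "(abs_l2 \<psi>, 0) \<in> gen" by (rule fixed_imp_gen_0)
  then have "(\<psi>, \<lambda>x. E\<^sub>0 * \<psi> x) \<in> H"
    using H_iff_gen[OF psi_L2 L2_scale[OF psi_L2, of E\<^sub>0]] by (simp add: abs_l2_scale psi_L2)
  moreover have "\<not> (AE x in lborel. \<psi> x = 0)"
  proof
    assume "AE x in lborel. \<psi> x = 0"
    then have "abs_l2 \<psi> = 0" unfolding zero_l2_def by (subst abs_l2_eq_iff[OF psi_L2 L2_zero])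
    with norm_psi show False by simp
  qed
  moreover have "AE x in lborel. 0 < \<psi> x"
    using phi_props(2) u(2) by eventually_elim (use N in \<open>simp add: \<psi>_def\<close>)
  moreover have "L2_norm lborel \<psi> = 1" using norm_psi by (simp add: norm_abs_l2 psi_L2)
  ultimately have "AE x in lborel. \<psi> x = \<phi> x"
    using ground_state by (auto simp: ground_state_def eigenfunction_def E\<^sub>0_def Let_def)
  then have "abs_l2 \<psi> = abs_l2 \<phi>" by (subst abs_l2_eq_iff[OF psi_L2 phi_L2])
  then have "N *\<^sub>R abs_l2 \<phi> = N *\<^sub>R abs_l2 \<psi>" by simp
  also have "\<dots> = abs_l2 \<phi> + abs_l2 u" using N by (simp add: psi)
  finally have "abs_l2 u = (N - 1) *\<^sub>R abs_l2 \<phi>" by (simp add: scaleR_diff_left)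
  then show ?thesis by blast
qed

text \<open>Simplicity of the ground state energy. If \<open>f\<close> is fixed, then so is \<open>\<bar>f\<bar>\<close>: indeed \<open>Q\<^sub>t \<bar>f\<bar> \<ge> \<bar>Q\<^sub>t f\<bar> = \<bar>f\<bar>\<close>,
  while \<open>Q\<^sub>t\<close> does not increase the norm. So the preceding lemma applies to the positive and the
  negative part of \<open>f\<close>.\<close>

lemma fixed_vector_multiple:
  assumes fixed: "\<And>t. t \<ge> 0 \<Longrightarrow> Q t x = x"
  shows "\<exists>c. x = c *\<^sub>R abs_l2 \<phi>"
proof -
  obtain f where f: "f \<in> L2 lborel" "x = abs_l2 f" by (rule l2_cases)
  define a where "a y = \<bar>f y\<bar>" for y
  have a: "a \<in> L2 lborel" unfolding a_def[abs_def] by (rule L2_abs[OF f(1)])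
  have norm_a: "abs_l2 a \<bullet> abs_l2 a = x \<bullet> x"
    by (simp add: f a inner_abs_l2 L2_inner_def a_def)
  have Qa: "Q t (abs_l2 a) = abs_l2 a" if t: "t \<ge> 0" for t
  proof -
    have "AE y in lborel. shifted_T t f y = f y"
      using fixed[OF t] f t by (simp add: Q_abs abs_l2_eq_iff shifted_T_L2)
    then have "AE y in lborel. a y * a y \<le> shifted_T t a y * a y"
    proof eventually_elim
      fix y assume "shifted_T t f y = f y"
      then have "\<bar>f y\<bar> = exp (E\<^sub>0 * t) * \<bar>T t f y\<bar>" by (simp add: shifted_T_def abs_mult flip: \<open>shifted_T t f y = f y\<close>)
      also have "\<dots> \<le> shifted_T t a y" unfolding shifted_T_def a_def[abs_def] by (intro mult_left_mono abs_T_le) simp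
      finally show "a y * a y \<le> shifted_T t a y * a y" by (intro mult_right_mono) (simp_all add: a_def)
    qed
    then have "(\<integral>y. a y * a y \<partial>lborel) \<le> (\<integral>y. shifted_T t a y * a y \<partial>lborel)"
      by (intro integral_mono_AE L2_mult_integrable a shifted_T_L2 t)
    then have "abs_l2 a \<bullet> abs_l2 a \<le> Q t (abs_l2 a) \<bullet> abs_l2 a"
      using t a by (simp add: Q_abs inner_abs_l2 shifted_T_L2 L2_inner_def)
    moreover have "Q t (abs_l2 a) \<bullet> Q t (abs_l2 a) \<le> abs_l2 a \<bullet> abs_l2 a"
      using contr[OF t, of "abs_l2 a"] by (simp add: norm_le)
    ultimately have "(Q t (abs_l2 a) - abs_l2 a) \<bullet> (Q t (abs_l2 a) - abs_l2 a) \<le> 0"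
      by (simp add: inner_diff_left inner_diff_right inner_commute)
    then have "(Q t (abs_l2 a) - abs_l2 a) \<bullet> (Q t (abs_l2 a) - abs_l2 a) = 0"
      using inner_ge_zero by (rule antisym)
    then show ?thesis by simp
  qed
  have pos: "\<exists>c. (1 / 2) *\<^sub>R (abs_l2 a + s *\<^sub>R x) = c *\<^sub>R abs_l2 \<phi>" if s: "s = 1 \<or> s = -1" for s
  proof -
    have eq: "(1 / 2) *\<^sub>R (abs_l2 a + s *\<^sub>R x) = abs_l2 (\<lambda>y. (1 / 2) * (a y + s * f y))"
      by (simp add: f a abs_l2_scale abs_l2_add L2_scale L2_add)
    show ?thesis unfolding eq
    proof (rule nonneg_fixed_vector)
      show "(\<lambda>y. (1 / 2) * (a y + s * f y)) \<in> L2 lborel" by (intro L2_scale L2_add a f)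
      show "AE y in lborel. 0 \<le> (1 / 2) * (a y + s * f y)" using s by (auto simp: a_def)
      show "Q t (abs_l2 (\<lambda>y. (1 / 2) * (a y + s * f y))) = abs_l2 (\<lambda>y. (1 / 2) * (a y + s * f y))"
        if "t \<ge> 0" for t
        unfolding eq[symmetric] using that by (simp add: Q_scale Q_linear_comb Qa fixed)
    qed
  qed
  obtain c d where c: "(1 / 2) *\<^sub>R (abs_l2 a + 1 *\<^sub>R x) = c *\<^sub>R abs_l2 \<phi>"
    and d: "(1 / 2) *\<^sub>R (abs_l2 a + (-1) *\<^sub>R x) = d *\<^sub>R abs_l2 \<phi>"
    using pos by blast
  have "x = (1 / 2) *\<^sub>R (abs_l2 a + 1 *\<^sub>R x) - (1 / 2) *\<^sub>R (abs_l2 a + (-1) *\<^sub>R x)"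
  proof -
    have "(1 / 2) *\<^sub>R (abs_l2 a + 1 *\<^sub>R x) - (1 / 2) *\<^sub>R (abs_l2 a + (-1) *\<^sub>R x)
        = (1 / 2) *\<^sub>R ((abs_l2 a + 1 *\<^sub>R x) - (abs_l2 a + (-1) *\<^sub>R x))"
      by (simp only: scaleR_diff_right)
    also have "(abs_l2 a + 1 *\<^sub>R x) - (abs_l2 a + (-1) *\<^sub>R x) = x + x" by simp
    finally show ?thesis by (simp only: scaleR_half_double)
  qed
  then have "x = (c - d) *\<^sub>R abs_l2 \<phi>" unfolding c d by (simp add: scaleR_diff_left)
  then show ?thesis by blast
qed

text \<open>The joint probability is \<open>(\<phi> 1\<^sub>B, Q\<^bsub>t-s\<^esub> (\<phi> 1\<^sub>C))\<close>. The components along \<open>\<phi>\<close> give the product of the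
  marginal probabilities; the orthogonal components, of norm at most \<open>W(B)\<^bsup>1/2\<^esup>\<close> and \<open>W(C)\<^bsup>1/2\<^esup>\<close>, decay
  by the spectral gap.\<close>

theorem correlation_decay:
  obtains \<delta> where "\<delta> > 0"
    "\<And>s t B C. s \<le> t \<Longrightarrow> B \<in> sets borel \<Longrightarrow> C \<in> sets borel \<Longrightarrow>
      measure P {\<omega> \<in> space P. \<omega> s \<in> B \<and> \<omega> t \<in> C}
        \<le> measure W B * measure W C + exp (- \<delta> * (t - s)) * sqrt (measure W B * measure W C)"
proof -
  obtain \<delta> where d: "\<delta> > 0" "\<And>\<mu>. 0 < \<mu> \<Longrightarrow> \<mu> < \<delta> \<Longrightarrow> resolvent_at \<mu>"
    using spectral_gap by blast
  interpret W: prob_space W by (rule prob_space_W)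
  have "measure P {\<omega> \<in> space P. \<omega> s \<in> B \<and> \<omega> t \<in> C}
        \<le> measure W B * measure W C + exp (- \<delta> * (t - s)) * sqrt (measure W B * measure W C)"
    if st: "s \<le> t" and B: "B \<in> sets borel" and C: "C \<in> sets borel" for s t B C
  proof -
    define v where "v B = abs_l2 (\<lambda>x. \<phi> x * indicator B x)" for B
    define w where "w B = v B - measure W B *\<^sub>R abs_l2 \<phi>" for B
    have ind: "indicator B \<in> L2 W" "(\<lambda>x. \<phi> x * indicator B x) \<in> L2 lborel"
      "v B \<bullet> abs_l2 \<phi> = measure W B" "v B \<bullet> v B = measure W B" if B: "B \<in> sets borel" for B
    proof -
      show L2: "indicator B \<in> L2 W" by (rule indicator_L2_W[OF B])
      then show L2': "(\<lambda>x. \<phi> x * indicator B x) \<in> L2 lborel"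
        using B by (subst (asm) L2_W_iff) simp_all
      show "v B \<bullet> abs_l2 \<phi> = measure W B"
        by (simp add: v_def inner_abs_l2 L2' phi_L2 inner_indicator_phi[OF B])
      have "L2_inner lborel (\<lambda>x. \<phi> x * indicator B x) (\<lambda>x. \<phi> x * indicator B x)
          = L2_inner lborel (\<lambda>x. \<phi> x * indicator B x) \<phi>"
        unfolding L2_inner_def by (intro Bochner_Integration.integral_cong) (auto simp: indicator_def)
      then show "v B \<bullet> v B = measure W B"
        by (simp add: v_def inner_abs_l2 L2' inner_indicator_phi[OF B])
    qed
    have phi1: "abs_l2 \<phi> \<bullet> abs_l2 \<phi> = 1" using norm_phi by (simp add: norm_eq_1)
    have w_orth: "w B \<bullet> abs_l2 \<phi> = 0" if "B \<in> sets borel" for B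
      by (simp add: w_def inner_diff_left ind[OF that] phi1)
    have w_norm: "norm (w B) \<le> sqrt (measure W B)" if B: "B \<in> sets borel" for B
    proof -
      have "w B \<bullet> w B = w B \<bullet> v B - measure W B * (w B \<bullet> abs_l2 \<phi>)"
        by (subst (2) w_def) (simp add: inner_diff_right)
      also have "\<dots> = v B \<bullet> v B - measure W B * (abs_l2 \<phi> \<bullet> v B)"
        using w_orth[OF B] by (simp add: w_def inner_diff_left)
      also have "abs_l2 \<phi> \<bullet> v B = measure W B"
        using ind(3)[OF B] by (simp only: inner_commute)
      finally have "w B \<bullet> w B = measure W B - (measure W B)\<^sup>2"
        by (simp add: ind(4)[OF B] power2_eq_square)
      then show ?thesis unfolding norm_eq_sqrt_inner by simp
    qed
    have "measure P {\<omega> \<in> space P. \<omega> s \<in> B \<and> \<omega> t \<in> C}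
        = (\<integral>\<omega>. indicator {\<omega> \<in> space P. \<omega> s \<in> B \<and> \<omega> t \<in> C} \<omega> \<partial>P)"
    proof -
      have "{\<omega> \<in> space P. \<omega> s \<in> B \<and> \<omega> t \<in> C} \<inter> space P = {\<omega> \<in> space P. \<omega> s \<in> B \<and> \<omega> t \<in> C}"
        by blast
      then show ?thesis by (simp only: Bochner_Integration.integral_indicator)
    qed
    also have "\<dots> = (\<integral>\<omega>. indicator B (\<omega> s) * indicator C (\<omega> t) \<partial>P)"
      by (intro Bochner_Integration.integral_cong) (auto simp: indicator_def)
    also have "\<dots> = v B \<bullet> Q (t - s) (v C)"
      using st two_time_formula[OF st ind(1)[OF B] ind(1)[OF C]] ind(2)[OF B] ind(2)[OF C]
      by (simp add: v_def Q_abs inner_abs_l2 shifted_T_L2)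
    also have "\<dots> = (measure W B *\<^sub>R abs_l2 \<phi> + w B) \<bullet> Q (t - s) (measure W C *\<^sub>R abs_l2 \<phi> + w C)"
      by (simp add: w_def)
    also have "\<dots> = measure W B * measure W C + w B \<bullet> Q (t - s) (w C)"
      using st w_orth[OF B] w_orth[OF C] Q_symmetric[of "t - s" "abs_l2 \<phi>" "w C"]
      by (simp add: Q_linear_comb Q_scale Q_phi inner_add_left inner_add_right phi1 inner_commute[of "abs_l2 \<phi>" "w C"])
    also have "w B \<bullet> Q (t - s) (w C) \<le> norm (w B) * norm (Q (t - s) (w C))"
      by (rule norm_cauchy_schwarz)
    also have "\<dots> \<le> sqrt (measure W B) * (exp (- \<delta> * (t - s)) * sqrt (measure W C))"
    proof (intro mult_mono w_norm B)
      have "norm (Q (t - s) (w C)) \<le> exp (- \<delta> * (t - s)) * norm (w C)"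
        by (rule spectral_gap_decay[OF d(2) d(1) fixed_vector_multiple Q_phi norm_phi w_orth[OF C]])
          (use st in auto)
      also have "\<dots> \<le> exp (- \<delta> * (t - s)) * sqrt (measure W C)"
        by (intro mult_left_mono w_norm C) simp
      finally show "norm (Q (t - s) (w C)) \<le> exp (- \<delta> * (t - s)) * sqrt (measure W C)" .
    qed simp_all
    finally show ?thesis by (simp add: real_sqrt_mult mult_ac)
  qed
  with d(1) show thesis by (rule that)
qed

end

section \<open>The upper limit of the transformed process\<close>

context ground_state_transform
begin

lemma scaled_tail_integral:
  assumes c: "c > 0"
  shows "ennreal (c ^ DIM('a)) * (\<integral>\<^sup>+ x\<in>{x. \<rho> \<le> norm x}. ennreal ((\<phi> (c *\<^sub>R x))\<^sup>2) \<partial>lborel)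
    = emeasure W {x. c * \<rho> \<le> norm x}"
proof -
  let ?h = "\<lambda>y. ennreal ((\<phi> y)\<^sup>2) * indicator {y. c * \<rho> \<le> norm y} y"
  have h: "?h \<in> borel_measurable borel" by measurable
  have "emeasure W {x. c * \<rho> \<le> norm x} = (\<integral>\<^sup>+y. ?h y \<partial>lborel)"
    unfolding weighted_def by (rule emeasure_density) measurable
  also have "\<dots> = (\<integral>\<^sup>+y. ?h y \<partial>density (distr lborel borel (\<lambda>x. 0 + c *\<^sub>R x)) (\<lambda>_. \<bar>c\<bar> ^ DIM('a)))"
    using c by (subst lborel_affine[where c=c and t=0]) simp_all
  also have "\<dots> = (\<integral>\<^sup>+y. ennreal (c ^ DIM('a)) * ?h y \<partial>distr lborel borel (\<lambda>x. 0 + c *\<^sub>R x))"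
    using c h by (subst nn_integral_density) auto
  also have "\<dots> = (\<integral>\<^sup>+x. ennreal (c ^ DIM('a)) * ?h (0 + c *\<^sub>R x) \<partial>lborel)"
    using h by (subst nn_integral_distr) auto
  also have "\<dots> = (\<integral>\<^sup>+x. ennreal (c ^ DIM('a)) *
      (ennreal ((\<phi> (c *\<^sub>R x))\<^sup>2) * indicator {x. \<rho> \<le> norm x} x) \<partial>lborel)"
    using c by (intro nn_integral_cong) (auto simp: indicator_def)
  also have "\<dots> = ennreal (c ^ DIM('a)) * (\<integral>\<^sup>+ x\<in>{x. \<rho> \<le> norm x}. ennreal ((\<phi> (c *\<^sub>R x))\<^sup>2) \<partial>lborel)"
    by (rule nn_integral_cmult) measurable
  finally show ?thesis by simp
qed

text \<open>Up to the factor \<open>c\<^sup>d\<close>, which comes from the substitution \<open>y = c x\<close>, the inner integral at \<open>r\<close> is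
  the stationary probability of \<open>\<bar>x\<bar> \<ge> c \<tau>(r)\<close>, which is non-increasing in \<open>r\<close>.\<close>

lemma I_fun_finite_iff:
  assumes c: "c > 0" and \<tau>: "mono_on {0..} \<tau>"
  shows "I_fun \<phi> c \<tau> < \<infinity> \<longleftrightarrow> summable (\<lambda>n. measure W {x. c * \<tau> (real n) \<le> norm x})"
proof -
  interpret W: prob_space W by (rule prob_space_W)
  define G where "G r = (\<integral>\<^sup>+ x\<in>{x. \<tau> r \<le> norm x}. ennreal ((\<phi> (c *\<^sub>R x))\<^sup>2) \<partial>lborel)" for r
  define K where "K = ennreal (c ^ DIM('a))"
  have K: "K \<noteq> 0" "K \<noteq> \<top>" using c by (auto simp: K_def)
  have KG: "K * G r = ennreal (measure W {x. c * \<tau> r \<le> norm x})" for r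
    unfolding K_def G_def scaled_tail_integral[OF c] by (rule W.emeasure_eq_measure)
  have "I_fun \<phi> c \<tau> = (\<integral>\<^sup>+ r\<in>{1..}. G r \<partial>lborel)" by (simp add: I_fun_def G_def)
  also have "\<dots> < \<infinity> \<longleftrightarrow> (\<Sum>n. G (real (Suc n))) < \<infinity>"
  proof (rule nn_integral_antimono_finite_iff)
    fix r s :: real assume "1 \<le> r" "r \<le> s"
    then have "\<tau> r \<le> \<tau> s" using \<tau> by (auto intro: mono_onD)
    then show "G s \<le> G r" unfolding G_def by (intro nn_integral_mono) (auto simp: indicator_def)
  next
    have "K * G 1 < \<infinity>" unfolding KG by simp
    then show "G 1 < \<infinity>" using K by (auto simp: ennreal_mult_less_top)
  qed
  also have "\<dots> \<longleftrightarrow> K * (\<Sum>n. G (real (Suc n))) < \<infinity>"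
    using K by (auto simp: ennreal_mult_less_top less_top)
  also have "K * (\<Sum>n. G (real (Suc n))) = (\<Sum>n. ennreal (measure W {x. c * \<tau> (real (Suc n)) \<le> norm x}))"
    unfolding KG[symmetric] by (rule ennreal_suminf_cmult[symmetric])
  also have "\<dots> < \<infinity> \<longleftrightarrow> summable (\<lambda>n. measure W {x. c * \<tau> (real (Suc n)) \<le> norm x})"
  proof
    assume "(\<Sum>n. ennreal (measure W {x. c * \<tau> (real (Suc n)) \<le> norm x})) < \<infinity>"
    then show "summable (\<lambda>n. measure W {x. c * \<tau> (real (Suc n)) \<le> norm x})"
      unfolding infinity_ennreal_def
      by (rule summable_suminf_not_top[OF measure_nonneg less_imp_neq])
  next
    assume "summable (\<lambda>n. measure W {x. c * \<tau> (real (Suc n)) \<le> norm x})"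
    then have "(\<Sum>n. ennreal (measure W {x. c * \<tau> (real (Suc n)) \<le> norm x})) \<noteq> \<top>"
      by (rule ennreal_suminf_neq_top) (rule measure_nonneg)
    then show "(\<Sum>n. ennreal (measure W {x. c * \<tau> (real (Suc n)) \<le> norm x})) < \<infinity>"
      unfolding infinity_ennreal_def by (rule top.not_eq_extremum[THEN iffD1])
  qed
  also have "\<dots> \<longleftrightarrow> summable (\<lambda>n. measure W {x. c * \<tau> (real n) \<le> norm x})"
    by (rule summable_Suc_iff)
  finally show ?thesis .
qed

theorem limsup_eq_c_fun:
  assumes \<tau>: "\<And>r. 0 \<le> r \<Longrightarrow> 0 < \<tau> r" "mono_on {0..} \<tau>"
  shows "AE \<omega> in P. limsup (\<lambda>n::nat. ennreal (norm (\<omega> (real n)) / \<tau> (real n))) = c_fun \<phi> \<tau>"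
  unfolding c_fun_def
proof (rule AE_limsup_eq_threshold)
  define B where "B c n = {x :: 'a. c * \<tau> (real n) \<le> norm x}" for c and n :: nat
  define A where "A c n = {\<omega> \<in> space P. norm (\<omega> (real n)) \<ge> c * \<tau> (real n)}" for c and n :: nat
  have B: "B c n \<in> sets borel" for c n unfolding B_def by measurable
  have A_vimage: "A c n = (\<lambda>\<omega>. \<omega> (real n)) -` B c n \<inter> space P" for c n
    by (auto simp: A_def B_def)
  have A: "A c n \<in> sets P" for c n
    unfolding A_vimage by (rule measurable_sets[OF coordinate_measurable B])
  have prob_A: "measure P (A c n) = measure W (B c n)" for c n
    unfolding A_vimage using measure_distr[OF coordinate_measurable B, of "real n" c n]
    by (simp only: marginal)
  show "0 < \<tau> (real n)" for n by (rule \<tau>) simp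
  show "AE \<omega> in P. \<forall>\<^sub>F n in sequentially. norm (\<omega> (real n)) < c * \<tau> (real n)"
    if c: "c > 0" and I: "I_fun \<phi> c \<tau> < \<infinity>" for c
  proof -
    have "summable (\<lambda>n. measure P (A c n))"
      using I unfolding I_fun_finite_iff[OF c \<tau>(2)] prob_A B_def .
    then have "AE \<omega> in P. \<forall>\<^sub>F n in sequentially. \<omega> \<in> space P - A c n"
      by (intro borel_cantelli_AE1 A) (simp_all add: less_top[symmetric])
    then show ?thesis
      by eventually_elim (auto simp: A_def not_le elim: eventually_mono)
  qed
  show "AE \<omega> in P. \<exists>\<^sub>F n in sequentially. c * \<tau> (real n) \<le> norm (\<omega> (real n))"
    if c: "c > 0" and I: "\<not> I_fun \<phi> c \<tau> < \<infinity>" for c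
  proof -
    obtain \<delta> where d: "\<delta> > 0"
      "\<And>s t B C. s \<le> t \<Longrightarrow> B \<in> sets borel \<Longrightarrow> C \<in> sets borel \<Longrightarrow>
        measure P {\<omega> \<in> space P. \<omega> s \<in> B \<and> \<omega> t \<in> C}
          \<le> measure W B * measure W C + exp (- \<delta> * (t - s)) * sqrt (measure W B * measure W C)"
      using correlation_decay by blast
    have "AE \<omega> in P. \<exists>\<^sub>F n in sequentially. \<omega> \<in> A c n"
    proof (rule P.borel_cantelli_decaying_correlations[OF A])
      show "0 \<le> exp (- \<delta>)" "exp (- \<delta>) < 1" using d(1) by simp_all
      show "\<not> summable (\<lambda>n. measure P (A c n))"
        using I unfolding I_fun_finite_iff[OF c \<tau>(2)] prob_A B_def .
      fix m n :: nat assume mn: "m < n"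
      have "A c m \<inter> A c n = {\<omega> \<in> space P. \<omega> (real m) \<in> B c m \<and> \<omega> (real n) \<in> B c n}"
        by (auto simp: A_def B_def)
      moreover have "exp (- \<delta> * (real n - real m)) = exp (- \<delta>) ^ (n - m)"
        using mn exp_of_nat_mult[of "n - m" "- \<delta>"] by (simp add: of_nat_diff mult.commute)
      ultimately show "measure P (A c m \<inter> A c n) \<le> measure P (A c m) * measure P (A c n)
          + exp (- \<delta>) ^ (n - m) * sqrt (measure P (A c m) * measure P (A c n))"
        using d(2)[OF _ B B, of "real m" "real n" c m c n] mn unfolding prob_A by simp
    qed
    then show ?thesis
      by eventually_elim (auto simp: A_def elim: frequently_elim1)
  qed
  show "I_fun \<phi> c' \<tau> < \<infinity>" if c: "0 < c" "c \<le> c'" "I_fun \<phi> c \<tau> < \<infinity>" for c c'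
  proof -
    interpret W: prob_space W by (rule prob_space_W)
    have sm: "summable (\<lambda>n. measure W (B c n))"
      using c(3) unfolding I_fun_finite_iff[OF c(1) \<tau>(2)] B_def .
    have le: "measure W (B c' n) \<le> measure W (B c n)" for n
    proof (rule W.finite_measure_mono)
      have "c * \<tau> (real n) \<le> c' * \<tau> (real n)"
        using c(2) \<tau>(1)[of "real n"] by (intro mult_right_mono) simp_all
      then show "B c' n \<subseteq> B c n" by (auto simp: B_def)
    qed (simp add: B)
    have "summable (\<lambda>n. measure W (B c' n))"
      by (rule summable_comparison_test'[OF sm, of 0]) (simp add: le)
    then show ?thesis
      using c(1,2) unfolding B_def by (subst I_fun_finite_iff[OF _ \<tau>(2)]) simp_all
  qed
qed

end

lemma abs_feynman_kac_le:
  "\<bar>feynman_kac M X V t f x\<bar> \<le> feynman_kac M X V t (\<lambda>y. \<bar>f y\<bar>) x"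
  unfolding feynman_kac_def
  using integral_abs_bound[of M "\<lambda>w. exp (- (LINT s:{0..t}|lborel. V (x + X s w))) * f (x + X t w)"]
  by (simp add: abs_mult)

theorem corollary3p1:
  fixes M :: "'w measure"
    and X :: "real \<Rightarrow> 'w \<Rightarrow> real^'n"
    and A :: "real^'n^'n"
    and nu :: "real^'n \<Rightarrow> real"
    and N :: "(real^'n) measure"
    and V :: "real^'n \<Rightarrow> real"
    and H :: "(real^'n) operator"
    and \<phi>\<^sub>0 :: "real^'n \<Rightarrow> real"
    and Px :: "real^'n \<Rightarrow> (real \<Rightarrow> real^'n) measure"
    and \<tau> :: "real \<Rightarrow> real"
  assumes A: "transpose A = A" "\<And>\<xi>. 0 \<le> (A *v \<xi>) \<bullet> \<xi>"
    and nu: "nu \<in> borel_measurable borel" "\<And>x. x \<noteq> 0 \<Longrightarrow> 0 < nu x"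
    and N: "N = density lborel (\<lambda>x. ennreal (nu x))" "levy_measure N" "symmetric_measure N"
      "emeasure N (UNIV - {0}) = \<infinity>"
    and X: "levy_process M X"
      "\<And>t \<xi>. 0 \<le> t \<Longrightarrow>
         (\<integral>w. cis (\<xi> \<bullet> X t w) \<partial>M) = of_real (exp (- (t * levy_symbol A N \<xi>)))"
    and V: "kato_potential M X V"
    and H: "H = form_sum (neg_operator (levy_generator (levy_symbol A N))) V"
      "self_adjoint H" "bounded_from_below H" "is_exp_semigroup (feynman_kac M X V) H"
    and lambda0: "isolated_eigenvalue H (Inf (Spec H))"
    and phi0: "ground_state H \<phi>\<^sub>0"
    and gst: "gst_process (gst_semigroup (feynman_kac M X V) (Inf (Spec H)) \<phi>\<^sub>0) \<phi>\<^sub>0 Px"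
    and tau: "\<And>r. 0 \<le> r \<Longrightarrow> 0 < \<tau> r" "mono_on {0..} \<tau>"
  shows "AE \<omega> in path_measure \<phi>\<^sub>0 Px.
           limsup (\<lambda>n::nat. ennreal (norm (\<omega> (real n)) / \<tau> (real n))) = c_fun \<phi>\<^sub>0 \<tau>"
proof -
  interpret ground_state_transform "feynman_kac M X V" H \<phi>\<^sub>0 Px
  proof
    show "\<bar>feynman_kac M X V t f x\<bar> \<le> feynman_kac M X V t (\<lambda>y. \<bar>f y\<bar>) x" for t f x
      by (rule abs_feynman_kac_le)
  qed (fact H lambda0 phi0 gst)+
  show ?thesis using limsup_eq_c_fun[OF tau] unfolding P_def .
qed

end
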